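(* Let $\Phi$ be an irreducible crystallographic root system with positive roots $\Phi^+$ and simple roots $\Delta=\{\alpha_1,\dots,\alpha_\ell\}$, and let $k$ be a positive integer. Let $\varphi_1^+,\dots,\varphi_\ell^+$ be an SRB$+$ and $\varphi_1^-,\dots,\varphi_\ell^-$ an SRB$-$ (as defined in the context). For $1\le i\le\ell$ let $s_i$ denote the simple reflection with respect to $\alpha_i$, with $s_i(\alpha_i)=-\alpha_i$. (1) If $1\le j\le\ell$ and $i\ne j$, then $s_i(\varphi_j^+)=\varphi_j^+$. (2) If we express $\varphi_i^-=(\alpha_i-kz)\hat\varphi_i^-$ (with $\hat\varphi_i^-\in\operatorname{Der}(S(E^* ))$), then $s_i(\hat\varphi_i^-)=\hat\varphi_i^-$.
   Context: $V$ is an $\ell$-dimensional Euclidean space with inner product $I$, $I^*$ is the induced inner product on $V^*$, $\Phi\subset V^*$ is an irreducible crystallographic root system of rank $\ell$ with Weyl group $W$ and Coxeter number $h$. For $\alpha\in\Phi^+$, $j\in\mathbb Z$, let $H_{\alpha,j}=\{x\in V\mid \alpha(x)=j\}$, $H_\alpha=H_{\alpha,0}$, and $\mathcal A(\Phi)=\{H_\alpha\mid\alpha\in\Phi^+\}$. Let $E=\mathbb R^{\ell+1}$ with $E^*=V^*\oplus\mathbb Rz$ ($V$ is embedded in $E$ as the affine hyperplane $z=1$), and let $S(V^* )$, $S(E^* )$ be the rings of polynomial functions. The cone of the extended Shi arrangement $\mathit{Shi}^k=\{H_{\alpha,j}\mid\alpha\in\Phi^+,\ -k+1\le j\le k\}$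 is the central arrangement $\mathcal S^k$ in $E$ consisting of $\{z=0\}$ and the hyperplanes $\{\alpha-jz=0\}$ for $\alpha\in\Phi^+$, $-k+1\le j\le k$. $\operatorname{Der}(R)$ is the module of $\mathbb R$-linear derivations of $R$ to itself. A derivation $\theta$ is homogeneous of degree $d$ if $\theta(\alpha)$ is zero or a homogeneous polynomial of degree $d$ for every linear form $\alpha$; $(\cdot)_d$ denotes the vector space of homogeneous elements of degree $d$ (including $0$). Define $D_0(\mathcal S^k)=\{\theta\in\operatorname{Der}(S(E^* ))\mid \theta(\alpha_H)\in\alpha_HS(E^* )\ \text{for all } H\in\mathcal S^k,\ \theta(z)=0\}$, where $H=\ker\alpha_H$, and $D(\mathcal A(\Phi),2k)=\{\theta\in\operatorname{Der}(S(V^* ))\mid\theta(\alpha)\in\alpha^{2k}S(V^* )\ \text{for all }\alpha\in\Phi^+\}$. The Ziegler restriction map $\mathbf{res}:D_0(\mathcal S^k)\to D(\mathcal A(\Phi),2k)$ is given by setting $z=0$. It is known that it restricts to a linear isomorphism $D_0(\mathcal S^k)_{kh}\to D(\mathcal A(\Phi),2k)_{kh}$, and that $D(\mathcal A(\Phi),2k)_{kh}$ is isomorphic to $V$ as a $W$-module. Simple-root bases: pick a $W$-isomorphism $\Xi:V\to D(\mathcal A(\Phi),2k)_{kh}$ (unique up to a nonzero scalar by Schur's lemma) and set $\Theta=\mathbf{res}^{-1}\circ\Xi:V\to D_0(\mathcal S^k)_{kh}$. Let $\alpha_1^*,\dots,\alpha_\ell^*\in V$ be the basis dual to $\alpha_1,\dots,\alpha_\ell$.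 The derivations $\varphi_j^+=\Theta(\alpha_j^* )$ ($1\le j\le\ell$) are called a simple-root basis plus (SRB$+$), and the derivations $\varphi_j^-=\sum_{p=1}^\ell I^*(\alpha_j,\alpha_p)\varphi_p^+$ ($1\le j\le\ell$) are called a simple-root basis minus (SRB$-$). Each $\varphi_i^-$ is divisible by $\alpha_i-kz$ in $\operatorname{Der}(S(E^* ))$. $W$ acts on $E^*$ by its action on $V^*$ and trivially on $z$, hence on $S(E^* )$ by ring automorphisms, and on derivations by $(w\theta)(f)=w(\theta(w^{-1}f))$. *)

theory Defs
  imports "HOL-Analysis.Analysis"
begin

section \<open>Rings of polynomial functions\<close>

text \<open>
  For a finite-dimensional real vector space \<open>U\<close> the type \<open>'u polyfun\<close> is the ring \<open>S(U\<^sup>*)\<close> of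
  polynomial functions on \<open>U\<close>.  Below, \<open>V\<close> is a type \<open>'a\<close> of class \<^class>\<open>euclidean_space\<close>,
  \<open>\<ell> = DIM('a)\<close>, the dual space \<open>V\<^sup>*\<close> is \<open>'a \<Rightarrow>\<^sub>L real\<close>, and \<open>E\<close> is \<open>'a \<times> real\<close>, with \<open>z\<close> the
  second projection.
\<close>

typedef (overloaded) ('a::real_normed_vector) polyfun =
    "{f :: 'a \<Rightarrow> real. real_polynomial_function f}"
  morphisms poly_fun Abs_polyfun
  by auto

setup_lifting type_definition_polyfun

instantiation polyfun :: (real_normed_vector) comm_ring_1
begin

lift_definition zero_polyfun :: "'a polyfun" is "\<lambda>_. 0" by auto
lift_definition one_polyfun :: "'a polyfun" is "\<lambda>_. 1" by auto
lift_definition plus_polyfun :: "'a polyfun \<Rightarrow> 'a polyfun \<Rightarrow> 'a polyfun"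
  is "\<lambda>f g x. f x + g x" by auto
lift_definition minus_polyfun :: "'a polyfun \<Rightarrow> 'a polyfun \<Rightarrow> 'a polyfun"
  is "\<lambda>f g x. f x - g x" by auto
lift_definition uminus_polyfun :: "'a polyfun \<Rightarrow> 'a polyfun"
  is "\<lambda>f x. - f x" by auto
lift_definition times_polyfun :: "'a polyfun \<Rightarrow> 'a polyfun \<Rightarrow> 'a polyfun"
  is "\<lambda>f g x. f x * g x" by auto

instance
  by standard (transfer; simp add: algebra_simps fun_eq_iff)+

end

instantiation polyfun :: (real_normed_vector) real_vector
begin

lift_definition scaleR_polyfun :: "real \<Rightarrow> 'a polyfun \<Rightarrow> 'a polyfun"
  is "\<lambda>c f x. c * f x" by auto

instance
  by standard (transfer; simp add: algebra_simps fun_eq_iff)+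

end

lift_definition lform :: "('a::real_normed_vector \<Rightarrow>\<^sub>L real) \<Rightarrow> 'a polyfun"
  is blinfun_apply
  by (auto intro: blinfun.bounded_linear_right)

lift_definition pullback ::
    "('a::real_normed_vector \<Rightarrow>\<^sub>L 'b::real_normed_vector) \<Rightarrow> 'b polyfun \<Rightarrow> 'a polyfun"
  is "\<lambda>L f x. f (blinfun_apply L x)"
proof -
  fix L :: "'a \<Rightarrow>\<^sub>L 'b" and f :: "'b \<Rightarrow> real"
  assume "real_polynomial_function f"
  then show "real_polynomial_function (\<lambda>x. f (blinfun_apply L x))"
    by induction (auto intro: bounded_linear_compose blinfun.bounded_linear_right)
qed

text \<open>
  A polynomial function over the reals is zero or homogeneous of degree \<open>d\<close> precisely if it scales
  by \<open>c\<^sup>d\<close>; the convention \<open>0\<^sup>0 = 1\<close> makes this correct for \<open>d = 0\<close>.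
\<close>
definition homogeneous_poly :: "nat \<Rightarrow> 'a::real_normed_vector polyfun \<Rightarrow> bool" where
  "homogeneous_poly d f \<longleftrightarrow> (\<forall>c x. poly_fun f (c *\<^sub>R x) = c ^ d * poly_fun f x)"

lemma poly_fun_simps [simp]:
  "poly_fun 0 x = 0" "poly_fun 1 x = 1" "poly_fun (f + g) x = poly_fun f x + poly_fun g x"
  "poly_fun (f - g) x = poly_fun f x - poly_fun g x" "poly_fun (- f) x = - poly_fun f x"
  "poly_fun (f * g) x = poly_fun f x * poly_fun g x" "poly_fun (c *\<^sub>R f) x = c * poly_fun f x"
  "poly_fun (lform a) x = blinfun_apply a x"
  "poly_fun (pullback L h) y = poly_fun h (blinfun_apply L y)"
  by (transfer; simp)+

lemma polyfun_eqI: "(\<And>x. poly_fun f x = poly_fun g x) \<Longrightarrow> f = g"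
  by transfer auto


section \<open>Derivations\<close>

definition Der :: "('a::real_normed_vector polyfun \<Rightarrow> 'a polyfun) set" where
  "Der = {\<theta>. linear \<theta> \<and> (\<forall>f g. \<theta> (f * g) = \<theta> f * g + f * \<theta> g)}"

definition degree_part ::
    "('a::real_normed_vector polyfun \<Rightarrow> 'a polyfun) set \<Rightarrow> nat \<Rightarrow> ('a polyfun \<Rightarrow> 'a polyfun) set" where
  "degree_part M d = {\<theta> \<in> M. \<forall>a. homogeneous_poly d (\<theta> (lform a))}"

text \<open>
  An arrangement is a set of hyperplanes; a defining form \<open>a\<close> of \<open>H\<close> is any linear form with
  kernel \<open>H\<close>.
\<close>
definition log_derivations ::
    "'a::real_normed_vector set set \<Rightarrow> ('a polyfun \<Rightarrow> 'a polyfun) set" where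
  "log_derivations \<A> =
     {\<theta> \<in> Der. \<forall>a. {x. blinfun_apply a x = 0} \<in> \<A> \<longrightarrow> lform a dvd \<theta> (lform a)}"

definition D0 :: "('a::real_normed_vector \<times> real) set set \<Rightarrow>
    (('a \<times> real) polyfun \<Rightarrow> ('a \<times> real) polyfun) set" where
  "D0 \<A> = {\<theta> \<in> log_derivations \<A>. \<theta> (lform snd_blinfun) = 0}"

definition multi_derivations ::
    "('a::real_normed_vector \<Rightarrow>\<^sub>L real) set \<Rightarrow> nat \<Rightarrow> ('a polyfun \<Rightarrow> 'a polyfun) set" where
  "multi_derivations P m = {\<theta> \<in> Der. \<forall>\<alpha>\<in>P. lform \<alpha> ^ m dvd \<theta> (lform \<alpha>)}"

definition zero_section :: "'a::real_normed_vector \<Rightarrow>\<^sub>L ('a \<times> real)" where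
  "zero_section = Blinfun (\<lambda>x. (x, 0))"

lemma zero_section_apply [simp]: "blinfun_apply zero_section x = (x, 0)"
  unfolding zero_section_def
  by (subst bounded_linear_Blinfun_apply)
     (intro bounded_linear_Pair bounded_linear_ident bounded_linear_zero refl)+

text \<open>Extend \<open>f\<close> from \<open>V\<close> to \<open>E\<close> independently of \<open>z\<close>, apply \<open>\<theta>\<close>, then set \<open>z = 0\<close>.\<close>
definition ziegler_res ::
    "(('a::real_normed_vector \<times> real) polyfun \<Rightarrow> ('a \<times> real) polyfun) \<Rightarrow> 'a polyfun \<Rightarrow> 'a polyfun"
  where "ziegler_res \<theta> = (\<lambda>f. pullback zero_section (\<theta> (pullback fst_blinfun f)))"


section \<open>Root systems in the dual space\<close>

definition riesz :: "('a::euclidean_space \<Rightarrow>\<^sub>L real) \<Rightarrow> 'a" where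
  "riesz \<alpha> = (\<Sum>b\<in>Basis. blinfun_apply \<alpha> b *\<^sub>R b)"

lemma riesz_inner: "riesz \<alpha> \<bullet> x = blinfun_apply \<alpha> x"
proof -
  have "blinfun_apply \<alpha> x = blinfun_apply \<alpha> (\<Sum>b\<in>Basis. (x \<bullet> b) *\<^sub>R b)"
    by (simp add: euclidean_representation)
  also have "\<dots> = riesz \<alpha> \<bullet> x"
    by (simp add: riesz_def blinfun.sum_right blinfun.scaleR_right inner_sum_left)
       (simp add: inner_commute mult.commute)
  finally show ?thesis by simp
qed

definition dual_inner :: "('a::euclidean_space \<Rightarrow>\<^sub>L real) \<Rightarrow> ('a \<Rightarrow>\<^sub>L real) \<Rightarrow> real" where
  "dual_inner \<alpha> \<beta> = riesz \<alpha> \<bullet> riesz \<beta>"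

definition dual_reflection ::
    "('a::euclidean_space \<Rightarrow>\<^sub>L real) \<Rightarrow> ('a \<Rightarrow>\<^sub>L real) \<Rightarrow> ('a \<Rightarrow>\<^sub>L real)" where
  "dual_reflection \<alpha> \<beta> = \<beta> - (2 * dual_inner \<beta> \<alpha> / dual_inner \<alpha> \<alpha>) *\<^sub>R \<alpha>"

definition root_system :: "('a::euclidean_space \<Rightarrow>\<^sub>L real) set \<Rightarrow> bool" where
  "root_system \<Phi> \<longleftrightarrow>
     finite \<Phi> \<and> 0 \<notin> \<Phi> \<and> span \<Phi> = UNIV \<and>
     (\<forall>\<alpha>\<in>\<Phi>. \<forall>\<beta>\<in>\<Phi>. dual_reflection \<alpha> \<beta> \<in> \<Phi>) \<and>
     (\<forall>\<alpha>\<in>\<Phi>. \<forall>c. c *\<^sub>R \<alpha> \<in> \<Phi> \<longrightarrow> c = 1 \<or> c = - 1)"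

definition crystallographic :: "('a::euclidean_space \<Rightarrow>\<^sub>L real) set \<Rightarrow> bool" where
  "crystallographic \<Phi> \<longleftrightarrow>
     (\<forall>\<alpha>\<in>\<Phi>. \<forall>\<beta>\<in>\<Phi>. 2 * dual_inner \<beta> \<alpha> / dual_inner \<alpha> \<alpha> \<in> \<int>)"

definition irreducible_roots :: "('a::euclidean_space \<Rightarrow>\<^sub>L real) set \<Rightarrow> bool" where
  "irreducible_roots \<Phi> \<longleftrightarrow> \<Phi> \<noteq> {} \<and>
     \<not> (\<exists>A B. A \<noteq> {} \<and> B \<noteq> {} \<and> A \<inter> B = {} \<and> A \<union> B = \<Phi> \<and>
            (\<forall>\<alpha>\<in>A. \<forall>\<beta>\<in>B. dual_inner \<alpha> \<beta> = 0))"

text \<open>\<open>\<alpha> 1, \<dots>, \<alpha> \<ell>\<close> enumerate without repetition a base of \<open>\<Phi>\<close> whose positive roots are \<open>P\<close>.\<close>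
definition simple_roots ::
    "('a::euclidean_space \<Rightarrow>\<^sub>L real) set \<Rightarrow> ('a \<Rightarrow>\<^sub>L real) set \<Rightarrow> (nat \<Rightarrow> 'a \<Rightarrow>\<^sub>L real) \<Rightarrow> bool" where
  "simple_roots \<Phi> P \<alpha> \<longleftrightarrow>
     \<alpha> ` {1..DIM('a)} \<subseteq> \<Phi> \<and> inj_on \<alpha> {1..DIM('a)} \<and>
     independent (\<alpha> ` {1..DIM('a)}) \<and> span (\<alpha> ` {1..DIM('a)}) = UNIV \<and>
     P = {\<beta> \<in> \<Phi>. \<exists>n :: nat \<Rightarrow> nat. \<beta> = (\<Sum>i = 1..DIM('a). real (n i) *\<^sub>R \<alpha> i)} \<and>
     \<Phi> = P \<union> uminus ` P"

definition dual_basis :: "(nat \<Rightarrow> 'a::euclidean_space \<Rightarrow>\<^sub>L real) \<Rightarrow> nat \<Rightarrow> 'a" where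
  "dual_basis \<alpha> j =
     (THE v. \<forall>i\<in>{1..DIM('a)}. blinfun_apply (\<alpha> i) v = (if i = j then 1 else 0))"


section \<open>The Weyl group and its actions\<close>

definition reflection :: "('a::euclidean_space \<Rightarrow>\<^sub>L real) \<Rightarrow> 'a \<Rightarrow>\<^sub>L 'a" where
  "reflection \<alpha> =
     Blinfun (\<lambda>x. x - (2 * blinfun_apply \<alpha> x / dual_inner \<alpha> \<alpha>) *\<^sub>R riesz \<alpha>)"

lemma reflection_apply:
  "blinfun_apply (reflection \<alpha>) x =
     x - (2 * blinfun_apply \<alpha> x / dual_inner \<alpha> \<alpha>) *\<^sub>R riesz \<alpha>"
proof -
  have "bounded_linear (\<lambda>x. (2 / dual_inner \<alpha> \<alpha>) * blinfun_apply \<alpha> x)"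
    by (intro bounded_linear_mult_right[THEN bounded_linear_compose] blinfun.bounded_linear_right)
  then have "bounded_linear (\<lambda>x. x - ((2 / dual_inner \<alpha> \<alpha>) * blinfun_apply \<alpha> x) *\<^sub>R riesz \<alpha>)"
    by (intro bounded_linear_sub bounded_linear_ident
        bounded_linear_compose[OF bounded_linear_scaleR_left])
  then show ?thesis
    by (simp add: reflection_def bounded_linear_Blinfun_apply)
qed

text \<open>\<open>W\<close> as a group of linear automorphisms of \<open>V\<close>.\<close>
inductive_set weyl_group :: "('a::euclidean_space \<Rightarrow>\<^sub>L real) set \<Rightarrow> ('a \<Rightarrow>\<^sub>L 'a) set"
  for \<Phi> :: "('a \<Rightarrow>\<^sub>L real) set" where
  weyl_id: "id_blinfun \<in> weyl_group \<Phi>"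
| weyl_reflection:
    "w \<in> weyl_group \<Phi> \<Longrightarrow> \<alpha> \<in> \<Phi> \<Longrightarrow> reflection \<alpha> o\<^sub>L w \<in> weyl_group \<Phi>"

definition blinfun_inv :: "('a::euclidean_space \<Rightarrow>\<^sub>L 'a) \<Rightarrow> ('a \<Rightarrow>\<^sub>L 'a)" where
  "blinfun_inv w = Blinfun (inv (blinfun_apply w))"

text \<open>
  For an automorphism \<open>w\<close> of \<open>U\<close> the contragredient action on \<open>U\<^sup>*\<close> is \<open>\<beta> \<mapsto> \<beta> \<circ> w\<^sup>-\<^sup>1\<close>, and its
  extension to \<open>S(U\<^sup>*)\<close> by ring automorphisms is \<open>f \<mapsto> f \<circ> w\<^sup>-\<^sup>1\<close>.
\<close>
definition poly_act :: "('a::euclidean_space \<Rightarrow>\<^sub>L 'a) \<Rightarrow> 'a polyfun \<Rightarrow> 'a polyfun" where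
  "poly_act w f = pullback (blinfun_inv w) f"

definition der_act ::
    "('a::euclidean_space \<Rightarrow>\<^sub>L 'a) \<Rightarrow> ('a polyfun \<Rightarrow> 'a polyfun) \<Rightarrow> 'a polyfun \<Rightarrow> 'a polyfun" where
  "der_act w \<theta> = (\<lambda>f. poly_act w (\<theta> (poly_act (blinfun_inv w) f)))"

text \<open>\<open>w\<close> acting on \<open>E = V \<times> \<real>\<close>, trivially on the second factor, hence fixing \<open>z\<close>.\<close>
definition cone_ext :: "('a::euclidean_space \<Rightarrow>\<^sub>L 'a) \<Rightarrow> ('a \<times> real) \<Rightarrow>\<^sub>L ('a \<times> real)" where
  "cone_ext w = Blinfun (\<lambda>p. (blinfun_apply w (fst p), snd p))"

lemma cone_ext_apply [simp]: "blinfun_apply (cone_ext w) p = (blinfun_apply w (fst p), snd p)"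
  unfolding cone_ext_def
  by (subst bounded_linear_Blinfun_apply)
     (intro bounded_linear_Pair blinfun.bounded_linear_right bounded_linear_snd refl
       bounded_linear_compose[OF blinfun.bounded_linear_right bounded_linear_fst])+

lemma reflection_involution:
  assumes "\<alpha> \<noteq> 0"
  shows "blinfun_apply (reflection \<alpha>) (blinfun_apply (reflection \<alpha>) x) = x"
proof -
  have "riesz \<alpha> \<noteq> 0"
    using assms by (metis blinfun_eqI inner_zero_left riesz_inner zero_blinfun.rep_eq)
  then have "dual_inner \<alpha> \<alpha> \<noteq> 0"
    by (simp add: dual_inner_def)
  moreover have "blinfun_apply \<alpha> (riesz \<alpha>) = dual_inner \<alpha> \<alpha>"
    by (simp add: dual_inner_def riesz_inner)
  ultimately show ?thesis
    by (simp add: reflection_apply blinfun.diff_right blinfun.scaleR_right algebra_simps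
        flip: scaleR_left.add)
qed

lemma blinfun_inv_involution:
  assumes "\<And>x. blinfun_apply w (blinfun_apply w x) = x"
  shows "blinfun_inv w = w"
proof -
  have "inv (blinfun_apply w) = blinfun_apply w"
    by (rule inv_unique_comp) (simp_all add: fun_eq_iff assms)
  then show ?thesis
    by (simp add: blinfun_inv_def blinfun_apply_inverse)
qed

lemma poly_act_reflection:
  assumes "\<alpha> \<noteq> 0"
  shows "poly_act (reflection \<alpha>) (lform \<beta>) = lform (dual_reflection \<alpha> \<beta>)"
  unfolding poly_act_def blinfun_inv_involution[OF reflection_involution[OF assms]]
  by (rule polyfun_eqI)
     (simp add: reflection_apply dual_reflection_def blinfun.diff_right blinfun.scaleR_right
       blinfun.diff_left blinfun.scaleR_left dual_inner_def riesz_inner)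

lemma poly_act_reflection_cone:
  assumes "\<alpha> \<noteq> 0"
  shows "poly_act (cone_ext (reflection \<alpha>)) f = pullback (cone_ext (reflection \<alpha>)) f"
    and "poly_act (cone_ext (reflection \<alpha>)) (lform snd_blinfun) = lform snd_blinfun"
proof -
  have inv: "blinfun_inv (cone_ext (reflection \<alpha>)) = cone_ext (reflection \<alpha>)"
    by (rule blinfun_inv_involution) (simp add: reflection_involution[OF assms])
  show "poly_act (cone_ext (reflection \<alpha>)) f = pullback (cone_ext (reflection \<alpha>)) f"
    by (simp add: poly_act_def inv)
  show "poly_act (cone_ext (reflection \<alpha>)) (lform snd_blinfun) = lform snd_blinfun"
    unfolding poly_act_def inv by (rule polyfun_eqI) simp
qed

definition coxeter_element :: "(nat \<Rightarrow> 'a::euclidean_space \<Rightarrow>\<^sub>L real) \<Rightarrow> 'a \<Rightarrow>\<^sub>L 'a" where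
  "coxeter_element \<alpha> =
     foldr (\<lambda>i w. reflection (\<alpha> i) o\<^sub>L w) [1..<Suc DIM('a)] id_blinfun"

definition coxeter_number :: "(nat \<Rightarrow> 'a::euclidean_space \<Rightarrow>\<^sub>L real) \<Rightarrow> nat" where
  "coxeter_number \<alpha> = (LEAST n. 0 < n \<and> (blinfun_apply (coxeter_element \<alpha>) ^^ n) = id)"


section \<open>Extended Shi arrangements and simple-root bases\<close>

definition cone_form :: "('a::euclidean_space \<Rightarrow>\<^sub>L real) \<Rightarrow> int \<Rightarrow> ('a \<times> real) \<Rightarrow>\<^sub>L real" where
  "cone_form \<alpha> j = (\<alpha> o\<^sub>L fst_blinfun) - real_of_int j *\<^sub>R snd_blinfun"

definition cone_shi :: "('a::euclidean_space \<Rightarrow>\<^sub>L real) set \<Rightarrow> nat \<Rightarrow> ('a \<times> real) set set" where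
  "cone_shi P k =
     insert {p. snd p = 0}
       {{p. blinfun_apply (cone_form \<alpha> j) p = 0} | \<alpha> j. \<alpha> \<in> P \<and> - int k + 1 \<le> j \<and> j \<le> int k}"

definition weyl_isomorphism ::
    "('a::euclidean_space \<Rightarrow>\<^sub>L real) set \<Rightarrow> ('a polyfun \<Rightarrow> 'a polyfun) set \<Rightarrow>
     ('a \<Rightarrow> 'a polyfun \<Rightarrow> 'a polyfun) \<Rightarrow> bool" where
  "weyl_isomorphism \<Phi> M \<Xi> \<longleftrightarrow>
     bij_betw \<Xi> UNIV M \<and> (\<forall>f. linear (\<lambda>v. \<Xi> v f)) \<and>
     (\<forall>w\<in>weyl_group \<Phi>. \<forall>v. \<Xi> (blinfun_apply w v) = der_act w (\<Xi> v))"

text \<open>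
  \<open>\<Theta> = res\<^sup>-\<^sup>1 \<circ> \<Xi>\<close> is expressed by saying that \<open>\<Theta> v\<close> is a preimage of \<open>\<Xi> v\<close> in the domain
  \<open>D\<^sub>0(S\<^sup>k)\<^sub>k\<^sub>h\<close> of the restriction map; since the restriction map is a
  bijection in that degree, the preimage exists and is unique.
\<close>
definition SRB_plus ::
    "('a::euclidean_space \<Rightarrow>\<^sub>L real) set \<Rightarrow> ('a \<Rightarrow>\<^sub>L real) set \<Rightarrow> (nat \<Rightarrow> 'a \<Rightarrow>\<^sub>L real) \<Rightarrow> nat \<Rightarrow>
     (nat \<Rightarrow> ('a \<times> real) polyfun \<Rightarrow> ('a \<times> real) polyfun) \<Rightarrow> bool" where
  "SRB_plus \<Phi> P \<alpha> k \<phi> \<longleftrightarrow>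
     (\<exists>\<Xi> \<Theta>.
        weyl_isomorphism \<Phi> (degree_part (multi_derivations P (2 * k)) (k * coxeter_number \<alpha>)) \<Xi> \<and>
        (\<forall>v. \<Theta> v \<in> degree_part (D0 (cone_shi P k)) (k * coxeter_number \<alpha>) \<and>
             ziegler_res (\<Theta> v) = \<Xi> v) \<and>
        (\<forall>j\<in>{1..DIM('a)}. \<phi> j = \<Theta> (dual_basis \<alpha> j)))"

definition SRB_minus ::
    "('a::euclidean_space \<Rightarrow>\<^sub>L real) set \<Rightarrow> ('a \<Rightarrow>\<^sub>L real) set \<Rightarrow> (nat \<Rightarrow> 'a \<Rightarrow>\<^sub>L real) \<Rightarrow> nat \<Rightarrow>
     (nat \<Rightarrow> ('a \<times> real) polyfun \<Rightarrow> ('a \<times> real) polyfun) \<Rightarrow> bool" where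
  "SRB_minus \<Phi> P \<alpha> k \<psi> \<longleftrightarrow>
     (\<exists>\<phi>. SRB_plus \<Phi> P \<alpha> k \<phi> \<and>
        (\<forall>j\<in>{1..DIM('a)}.
           \<psi> j = (\<lambda>f. \<Sum>p = 1..DIM('a). dual_inner (\<alpha> j) (\<alpha> p) *\<^sub>R \<phi> p f)))"

end

theory Submission
  imports Defs "HOL-Computational_Algebra.Factorial_Ring"
begin

text \<open>
  If \<open>\<phi>\<close> satisfies the conditions of the cone of \<open>Shi\<^sup>k\<close> except possibly the one at \<open>\<alpha>\<^sub>i = kz\<close>, then
  so does \<open>\<eta> = s\<^sub>i\<phi> - \<phi>\<close>, because \<open>s\<^sub>i\<close> permutes the remaining hyperplanes.  Moreover \<open>s\<^sub>i\<eta> = - \<eta>\<close>,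
  which forces the restriction of \<open>\<eta>\<close> to \<open>z = 0\<close> into \<open>D(A(\<Phi>), 2k)\<close> although one hyperplane is missing.
  Since \<open>D(A(\<Phi>), 2k)\<close> vanishes below degree \<open>kh\<close>, an \<open>\<eta>\<close> of degree below \<open>kh\<close> is divisible by \<open>z\<close>
  again and again, hence zero.  For part (2) take \<open>\<phi>\<close> to be the quotient of \<open>\<phi>\<^sub>i\<^sup>-\<close>, of degree \<open>kh - 1\<close>;
  for part (1), \<open>\<eta>\<close> has degree \<open>kh\<close>, but its restriction vanishes by equivariance of \<open>\<Xi>\<close>, and one
  argues with \<open>\<eta> / z\<close>.

  The vanishing below degree \<open>kh\<close> follows for \<open>\<ell> \<ge> 2\<close> from \<open>dim D(A(\<Phi>), 2k)\<^bsub>kh\<^esub> = \<ell>\<close> alone.  A nonzero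
  \<open>F\<close> in degree \<open>kh - 1\<close> would fill degree \<open>kh\<close> with its multiples by linear forms, so it would be
  unique up to scalars, nothing would exist in degree \<open>kh - 2\<close>, and the Dunkl operators, which preserve
  \<open>D(A(\<Phi>), 2k)\<close> and lower the degree, would annihilate \<open>F\<close>.  Then \<open>F\<close> would have a constant
  direction, and this line would be stable under the Weyl group, contradicting irreducibility.
\<close>

section \<open>Divisibility in rings of polynomial functions\<close>

lemma lform_linear:
  "lform (a + b) = lform a + lform b" "lform (a - b) = lform a - lform b"
  "lform (- a) = - lform a" "lform (c *\<^sub>R a) = c *\<^sub>R lform a" "lform 0 = 0"
  by (rule polyfun_eqI; simp add: blinfun.bilinear_simps)+

lemma linear_lform: "linear lform"
  by (rule linearI) (simp_all add: lform_linear)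

lemma lform_eq_iff [simp]: "lform a = lform b \<longleftrightarrow> a = b"
  by (metis blinfun_eqI poly_fun_simps(8))

lemma lform_eq_0_iff [simp]: "lform a = 0 \<longleftrightarrow> a = 0"
  by (metis lform_eq_iff lform_linear(5))

lemma polyfun_scaleR_mult:
  fixes f g :: "'a::real_normed_vector polyfun"
  shows "c *\<^sub>R f * g = c *\<^sub>R (f * g)" "f * c *\<^sub>R g = c *\<^sub>R (f * g)"
  by (rule polyfun_eqI; simp)+

lemma polyfun_scaleR_conv: "c *\<^sub>R f = (c *\<^sub>R 1) * (f :: 'a::real_normed_vector polyfun)"
  by (simp add: polyfun_scaleR_mult)

lemma polyfun_dvd_scaleR: "p dvd f \<Longrightarrow> p dvd c *\<^sub>R (f :: 'a::real_normed_vector polyfun)"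
  by (subst polyfun_scaleR_conv) simp

text \<open>The rules generating \<open>real_polynomial_function\<close> carry over to the type, a
  bounded linear map becoming some \<open>lform a\<close>; identities then reduce to linear forms
  and constants.\<close>

lemma polyfun_induct [case_names lform const add mult]:
  fixes f :: "'a::real_normed_vector polyfun"
  assumes lform: "\<And>a. Q (lform a)" and const: "\<And>c. Q (c *\<^sub>R 1)"
    and add: "\<And>f g. Q f \<Longrightarrow> Q g \<Longrightarrow> Q (f + g)" and mult: "\<And>f g. Q f \<Longrightarrow> Q g \<Longrightarrow> Q (f * g)"
  shows "Q f"
proof -
  have "\<exists>h. poly_fun h = p \<and> Q h" if "real_polynomial_function p" for p :: "'a \<Rightarrow> real"
    using that
  proof induction
    case (linear p)
    have "poly_fun (lform (Blinfun p)) = p"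
      using linear by (simp add: fun_eq_iff bounded_linear_Blinfun_apply)
    then show ?case using lform by blast
  next
    case (const c)
    have "poly_fun (c *\<^sub>R 1 :: 'a polyfun) = (\<lambda>x. c)" by (simp add: fun_eq_iff)
    then show ?case using assms(2) by blast
  next
    case (add p q)
    then obtain f g where "poly_fun f = p" "Q f" "poly_fun g = q" "Q g" by auto
    then have "poly_fun (f + g) = (\<lambda>x. p x + q x)" "Q (f + g)" using assms(3) by (auto simp: fun_eq_iff)
    then show ?case by blast
  next
    case (mult p q)
    then obtain f g where "poly_fun f = p" "Q f" "poly_fun g = q" "Q g" by auto
    then have "poly_fun (f * g) = (\<lambda>x. p x * q x)" "Q (f * g)" using assms(4) by (auto simp: fun_eq_iff)
    then show ?case by blast
  qed
  moreover have "real_polynomial_function (poly_fun f)"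
    using poly_fun[of f] by simp
  ultimately show ?thesis
    by (metis poly_fun_inject)
qed

lemma real_polynomial_function_line:
  "real_polynomial_function (\<lambda>t::real. poly_fun f (x + t *\<^sub>R y))"
proof (induction f rule: polyfun_induct)
  case (lform a)
  have "bounded_linear (\<lambda>t::real. t * blinfun_apply a y)"
    by (rule bounded_linear_mult_left)
  then show ?case
    by (auto simp: blinfun.bilinear_simps)
qed auto

lemma real_polynomial_function_infinite_zeros:
  fixes p :: "real \<Rightarrow> real"
  assumes "real_polynomial_function p" "infinite {t. p t = 0}"
  shows "p t = 0"
proof -
  obtain a n where p: "p = (\<lambda>x. \<Sum>i\<le>n. a i * x ^ i)"
    using assms(1) real_polynomial_function_iff_sum by blast
  then have "\<forall>i\<le>n. a i = 0"
    using assms(2) polyfun_finite_roots[of a n] by auto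
  then show ?thesis by (simp add: p)
qed

text \<open>On the line through \<open>x\<close> and \<open>y\<close> both polynomials are
  univariate and nonzero, at parameters 0 and 1 respectively, so only finitely many parameters are
  excluded. This yields the domain property and, inside a hyperplane, the primality of linear
  forms.\<close>

lemma polyfun_nonzero_on_line:
  fixes f g :: "'a::real_normed_vector polyfun"
  assumes "poly_fun f x \<noteq> 0" "poly_fun g y \<noteq> 0"
  shows "\<exists>t. poly_fun f (x + t *\<^sub>R (y - x)) \<noteq> 0 \<and> poly_fun g (x + t *\<^sub>R (y - x)) \<noteq> 0"
proof -
  let ?p = "\<lambda>h t. poly_fun h (x + t *\<^sub>R (y - x))"
  have "finite {t. ?p f t = 0}"
    using real_polynomial_function_infinite_zeros[OF real_polynomial_function_line, of f x "y - x" 0]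
      assms(1) by auto
  moreover have "finite {t. ?p g t = 0}"
    using real_polynomial_function_infinite_zeros[OF real_polynomial_function_line, of g x "y - x" 1]
      assms(2) by auto
  ultimately have "finite ({t. ?p f t = 0} \<union> {t. ?p g t = 0})" by simp
  then have "{t. ?p f t = 0} \<union> {t. ?p g t = 0} \<noteq> UNIV"
    using infinite_UNIV_char_0 by metis
  then show ?thesis by blast
qed

instance polyfun :: (real_normed_vector) idom
proof
  fix f g :: "'a polyfun"
  assume "f \<noteq> 0" "g \<noteq> 0"
  then obtain x y where "poly_fun f x \<noteq> 0" "poly_fun g y \<noteq> 0"
    by (metis polyfun_eqI poly_fun_simps(1))
  then show "f * g \<noteq> 0"
    by (metis polyfun_nonzero_on_line poly_fun_simps(1,6) mult_eq_0_iff)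
qed

section \<open>Linear forms as prime elements\<close>

lemma blinfun_real_obtain_one:
  fixes a :: "'a::real_normed_vector \<Rightarrow>\<^sub>L real"
  assumes "a \<noteq> 0"
  obtains w where "blinfun_apply a w = 1"
proof -
  obtain x where "blinfun_apply a x \<noteq> 0"
    using assms by (metis blinfun_eqI zero_blinfun.rep_eq)
  then have "blinfun_apply a ((1 / blinfun_apply a x) *\<^sub>R x) = 1"
    by (simp add: blinfun.bilinear_simps)
  then show ?thesis using that by blast
qed

text \<open>Project onto the kernel of \<open>a\<close> along a vector \<open>w\<close> with
  \<open>a w = 1\<close>: by induction, a polynomial differs from its composite with the projection
  by a multiple of \<open>a\<close>.\<close>

lemma lform_dvd_iff:
  assumes "a \<noteq> 0"
  shows "lform a dvd f \<longleftrightarrow> (\<forall>x. blinfun_apply a x = 0 \<longrightarrow> poly_fun f x = 0)"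
proof
  assume vanish: "\<forall>x. blinfun_apply a x = 0 \<longrightarrow> poly_fun f x = 0"
  obtain w where w: "blinfun_apply a w = 1"
    using assms blinfun_real_obtain_one by blast
  let ?\<pi> = "\<lambda>x. x - blinfun_apply a x *\<^sub>R w"
  have "\<exists>q. \<forall>x. poly_fun f x - poly_fun f (?\<pi> x) = blinfun_apply a x * poly_fun q x"
  proof (induction f rule: polyfun_induct)
    case (lform b)
    show ?case
      by (rule exI[of _ "blinfun_apply b w *\<^sub>R 1"]) (simp add: blinfun.bilinear_simps)
  next
    case (const c)
    show ?case by (rule exI[of _ 0]) simp
  next
    case (add f g)
    then obtain p q where pq: "\<And>x. poly_fun f x - poly_fun f (?\<pi> x) = blinfun_apply a x * poly_fun p x"
      "\<And>x. poly_fun g x - poly_fun g (?\<pi> x) = blinfun_apply a x * poly_fun q x" by blast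
    have "poly_fun (f + g) x - poly_fun (f + g) (?\<pi> x) = blinfun_apply a x * poly_fun (p + q) x" for x
      using pq[of x] unfolding poly_fun_simps distrib_left by linarith
    then show ?case by blast
  next
    case (mult f g)
    then obtain p q where p: "\<And>x. poly_fun f x - poly_fun f (?\<pi> x) = blinfun_apply a x * poly_fun p x"
      and q: "\<And>x. poly_fun g x - poly_fun g (?\<pi> x) = blinfun_apply a x * poly_fun q x" by blast
    \<comment> \<open>With \<open>f' = f - a p\<close> and \<open>g' = g - a q\<close> for the
      projected factors, this expands \<open>f g - f' g'\<close>.\<close>
    have "poly_fun (f * g) x - poly_fun (f * g) (?\<pi> x) =
      blinfun_apply a x * poly_fun (f * q + g * p - lform a * p * q) x" for x
      using p[of x] q[of x] unfolding poly_fun_simps by algebra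
    then show ?case by blast
  qed
  then obtain q where "\<And>x. poly_fun f x - poly_fun f (?\<pi> x) = blinfun_apply a x * poly_fun q x"
    by blast
  moreover have "poly_fun f (?\<pi> x) = 0" for x
    using vanish w by (simp add: blinfun.bilinear_simps)
  ultimately have "f = lform a * q"
    by (intro polyfun_eqI) simp
  then show "lform a dvd f" by simp
qed auto

lemma lform_dvd_lform_iff:
  assumes "a \<noteq> 0"
  shows "lform a dvd lform b \<longleftrightarrow> (\<exists>c. b = c *\<^sub>R a)"
proof
  assume "lform a dvd lform b"
  then have ker: "blinfun_apply b x = 0" if "blinfun_apply a x = 0" for x
    using that lform_dvd_iff[OF assms] by simp
  obtain w where w: "blinfun_apply a w = 1"
    using assms blinfun_real_obtain_one by blast
  have "b = blinfun_apply b w *\<^sub>R a"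
  proof (rule blinfun_eqI)
    fix x
    have "blinfun_apply b (x - blinfun_apply a x *\<^sub>R w) = 0"
      by (rule ker) (simp add: blinfun.bilinear_simps w)
    then show "blinfun_apply b x = blinfun_apply (blinfun_apply b w *\<^sub>R a) x"
      by (simp add: blinfun.bilinear_simps)
  qed
  then show "\<exists>c. b = c *\<^sub>R a" ..
qed (auto simp: lform_linear intro: polyfun_dvd_scaleR[OF dvd_refl])

text \<open>If neither factor vanishes on the whole kernel of \<open>a\<close>, the line joining two
  witnesses stays in the kernel and contains a point where the product is nonzero.\<close>

lemma prime_elem_lform:
  assumes "a \<noteq> 0"
  shows "prime_elem (lform a)"
proof (rule prime_elemI)
  show "\<not> lform a dvd 1"
    using lform_dvd_iff[OF assms, of 1] by (auto intro: exI[of _ 0])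
next
  fix f g assume fg: "lform a dvd f * g"
  show "lform a dvd f \<or> lform a dvd g"
  proof (rule ccontr)
    assume "\<not> (lform a dvd f \<or> lform a dvd g)"
    then obtain x y where xy: "blinfun_apply a x = 0" "blinfun_apply a y = 0"
      "poly_fun f x \<noteq> 0" "poly_fun g y \<noteq> 0"
      using lform_dvd_iff[OF assms] by blast
    then obtain t where "poly_fun (f * g) (x + t *\<^sub>R (y - x)) \<noteq> 0"
      using polyfun_nonzero_on_line by fastforce
    moreover have "blinfun_apply a (x + t *\<^sub>R (y - x)) = 0"
      using xy by (simp add: blinfun.bilinear_simps)
    ultimately show False
      using fg lform_dvd_iff[OF assms] by blast
  qed
qed (use assms in simp)

lemma prime_elem_power_dvd_mult:
  fixes p :: "'r::idom"
  assumes "prime_elem p" "\<not> p dvd b" "p ^ n dvd b * f"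
  shows "p ^ n dvd f"
  using assms(3)
proof (induction n)
  case (Suc n)
  then have "p ^ n dvd f"
    using dvd_trans[OF le_imp_power_dvd, of n "Suc n" p] by (simp add: dvd_mult_right)
  then obtain r where r: "f = p ^ n * r" ..
  have p0: "p ^ n \<noteq> 0" using assms(1) by auto
  have "p ^ n * p dvd p ^ n * (b * r)"
    using Suc.prems r by (simp add: ac_simps)
  then have "p dvd b * r" using p0 by (metis dvd_mult_cancel_left)
  then have "p dvd r" using assms(1,2) prime_elem_dvd_multD by blast
  then show ?case using r by (metis mult.commute mult_dvd_mono dvd_refl power_Suc)
qed simp

text \<open>The new prime divides none of the earlier ones, hence not their product, so it must
  divide the cofactor.\<close>

lemma prod_prime_elem_dvd:
  fixes p :: "'i \<Rightarrow> 'r::idom"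
  assumes "finite J" "\<And>j. j \<in> J \<Longrightarrow> prime_elem (p j)"
    and "\<And>i j. i \<in> J \<Longrightarrow> j \<in> J \<Longrightarrow> i \<noteq> j \<Longrightarrow> \<not> p i dvd p j"
    and "\<And>j. j \<in> J \<Longrightarrow> p j dvd f"
  shows "prod p J dvd f"
  using assms
proof (induction J rule: finite_induct)
  case (insert j J)
  then have "prod p J dvd f" by simp
  then obtain r where r: "f = prod p J * r" ..
  have pr: "prime_elem (p j)" using insert.prems by simp
  have "\<not> p j dvd prod p J"
  proof
    assume pJ: "p j dvd prod p J"
    have "\<exists>i\<in>J. p j dvd p i"
      using \<open>finite J\<close> pJ
    proof (induction J rule: finite_induct)
      case empty
      then show ?case using pr by (auto simp: prime_elem_def)
    next
      case (insert i K)
      then show ?case using pr prime_elem_dvd_multD by fastforce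
    qed
    then show False using insert.prems(2) insert.hyps by auto
  qed
  moreover have "p j dvd prod p J * r"
    using insert.prems(3) r by auto
  ultimately have "p j dvd r" using pr prime_elem_dvd_multD by blast
  then show ?case
    using insert.hyps r by (simp add: mult.commute mult_dvd_mono)
qed simp

section \<open>Pullback along linear maps\<close>

lemma pullback_simps:
  "pullback L (f + g) = pullback L f + pullback L g" "pullback L (f - g) = pullback L f - pullback L g"
  "pullback L (- f) = - pullback L f" "pullback L (f * g) = pullback L f * pullback L g"
  "pullback L (c *\<^sub>R f) = c *\<^sub>R pullback L f" "pullback L 0 = 0" "pullback L 1 = 1"
  "pullback L (f ^ n) = pullback L f ^ n" "pullback L (lform a) = lform (a o\<^sub>L L)"
proof -
  have mult: "pullback L (f * g) = pullback L f * pullback L g" for f g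
    by (rule polyfun_eqI) simp
  have one: "pullback L 1 = 1"
    by (rule polyfun_eqI) simp
  show "pullback L (f * g) = pullback L f * pullback L g" "pullback L 1 = 1" by fact+
  show "pullback L (f ^ n) = pullback L f ^ n"
    by (induction n) (simp_all add: mult one)
qed (rule polyfun_eqI; simp)+

lemma pullback_prod: "pullback L (prod f A) = (\<Prod>i\<in>A. pullback L (f i))"
  by (induction A rule: infinite_finite_induct) (simp_all add: pullback_simps)

lemma linear_pullback: "linear (pullback L)"
  by (rule linearI) (simp_all add: pullback_simps)

lemma pullback_dvd: "p dvd f \<Longrightarrow> pullback L p dvd pullback L f"
  by (auto simp: dvd_def pullback_simps)

section \<open>Homogeneous polynomial functions\<close>

text \<open>Both sides are polynomial in \<open>c\<close>, so agreement for nonzero \<open>c\<close>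
  extends to \<open>c = 0\<close>. Later proofs may therefore cancel powers of
  \<open>c\<close>.\<close>

lemma homogeneous_polyI:
  assumes "\<And>c x. c \<noteq> 0 \<Longrightarrow> poly_fun f (c *\<^sub>R x) = c ^ n * poly_fun f x"
  shows "homogeneous_poly n f"
  unfolding homogeneous_poly_def
proof (intro allI)
  fix c :: real and x
  let ?p = "\<lambda>t::real. poly_fun f (0 + t *\<^sub>R x) - t ^ n * poly_fun f x"
  have "real_polynomial_function ?p"
    by (intro real_polynomial_function_diff real_polynomial_function_line
        real_polynomial_function_power real_polynomial_function.intros bounded_linear_ident)
  moreover have "infinite {t. ?p t = 0}"
    by (rule infinite_super[of "{0<..}"]) (auto simp: assms infinite_Ioi)
  ultimately have "?p c = 0"
    by (rule real_polynomial_function_infinite_zeros)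
  then show "poly_fun f (c *\<^sub>R x) = c ^ n * poly_fun f x" by simp
qed

lemma homogeneous_poly_simps [simp]:
  "homogeneous_poly n 0" "homogeneous_poly (Suc 0) (lform a)" "homogeneous_poly 1 (lform a)"
  by (auto simp: homogeneous_poly_def blinfun.bilinear_simps)

lemma homogeneous_poly_add: "homogeneous_poly n f \<Longrightarrow> homogeneous_poly n g \<Longrightarrow> homogeneous_poly n (f + g)"
  by (auto simp: homogeneous_poly_def algebra_simps)

lemma homogeneous_poly_diff: "homogeneous_poly n f \<Longrightarrow> homogeneous_poly n g \<Longrightarrow> homogeneous_poly n (f - g)"
  by (auto simp: homogeneous_poly_def algebra_simps)

lemma homogeneous_poly_scaleR: "homogeneous_poly n f \<Longrightarrow> homogeneous_poly n (c *\<^sub>R f)"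
  by (auto simp: homogeneous_poly_def algebra_simps)

lemma homogeneous_poly_sum: "(\<And>i. i \<in> A \<Longrightarrow> homogeneous_poly n (f i)) \<Longrightarrow> homogeneous_poly n (sum f A)"
  by (induction A rule: infinite_finite_induct) (auto intro: homogeneous_poly_add)

lemma homogeneous_poly_mult:
  "homogeneous_poly m f \<Longrightarrow> homogeneous_poly n g \<Longrightarrow> homogeneous_poly (m + n) (f * g)"
  by (auto simp: homogeneous_poly_def power_add)

lemma homogeneous_poly_lform_mult: "homogeneous_poly n f \<Longrightarrow> homogeneous_poly (Suc n) (lform a * f)"
  using homogeneous_poly_mult[of "Suc 0" "lform a" n f] by simp

lemma homogeneous_poly_pullback: "homogeneous_poly n f \<Longrightarrow> homogeneous_poly n (pullback L f)"
  by (auto simp: homogeneous_poly_def blinfun.bilinear_simps)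

text \<open>The defect \<open>h\<close> of the scaling law for \<open>f\<close> is annihilated by
  the nonzero form, hence zero in a domain.\<close>

lemma homogeneous_poly_lform_cancel:
  assumes "homogeneous_poly (Suc n) (lform a * f)" "a \<noteq> 0"
  shows "homogeneous_poly n f"
proof (rule homogeneous_polyI)
  fix c :: real and x assume c: "c \<noteq> 0"
  define h where "h = pullback (c *\<^sub>R id_blinfun) f - c ^ n *\<^sub>R f"
  have "lform a * h = 0"
  proof (rule polyfun_eqI)
    fix y
    have "c * blinfun_apply a y * poly_fun f (c *\<^sub>R y) = c ^ Suc n * (blinfun_apply a y * poly_fun f y)"
      using assms(1) by (auto simp: homogeneous_poly_def blinfun.bilinear_simps)
    then have "blinfun_apply a y * poly_fun f (c *\<^sub>R y) = c ^ n * (blinfun_apply a y * poly_fun f y)"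
      using c by (simp add: mult.assoc)
    then show "poly_fun (lform a * h) y = poly_fun 0 y"
      by (simp add: h_def blinfun.bilinear_simps algebra_simps)
  qed
  then have "h = 0" using assms(2) by simp
  then have "poly_fun h x = 0" by simp
  then show "poly_fun f (c *\<^sub>R x) = c ^ n * poly_fun f x"
    by (simp add: h_def blinfun.bilinear_simps)
qed

text \<open>Stripping one linear factor lowers degree and exponent together; in degree 0 the
  polynomial is constant and vanishes at the origin.\<close>

lemma homogeneous_poly_lform_power_dvd:
  assumes "homogeneous_poly n f" "lform a ^ m dvd f" "a \<noteq> 0" "n < m"
  shows "f = 0"
  using assms
proof (induction n arbitrary: f m)
  case 0
  have "lform a dvd f"
    using 0 by (metis dvd_power dvd_trans)
  then have "poly_fun f 0 = 0"
    using lform_dvd_iff[OF \<open>a \<noteq> 0\<close>] by (simp add: blinfun.bilinear_simps)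
  moreover have "poly_fun f (0 *\<^sub>R x) = poly_fun f x" for x
    using 0 unfolding homogeneous_poly_def by (metis mult_1 power_0)
  ultimately show ?case
    by (intro polyfun_eqI) simp
next
  case (Suc n)
  obtain m' where m: "m = Suc m'" "n < m'"
    using Suc.prems(4) by (cases m) auto
  obtain q where f: "f = lform a * (lform a ^ m' * q)"
    using Suc.prems(2) m by (auto simp: dvd_def mult.assoc)
  then have "homogeneous_poly n (lform a ^ m' * q)"
    using Suc.prems homogeneous_poly_lform_cancel by blast
  then have "lform a ^ m' * q = 0"
    using Suc.IH[of "lform a ^ m' * q" m'] Suc.prems m by simp
  then show ?case using f by simp
qed

section \<open>Directional derivatives and derivations\<close>

lemma differentiable_poly_fun [simp]: "poly_fun f differentiable (at x)"
  for f :: "'a::euclidean_space polyfun"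
  using poly_fun[of f] differentiable_at_real_polynomial_function by blast

lemma poly_fun_has_derivative:
  "(poly_fun f has_derivative frechet_derivative (poly_fun f) (at x)) (at x)"
  for f :: "'a::euclidean_space polyfun"
  using differentiable_poly_fun frechet_derivative_works by blast

lemma frechet_derivative_poly_fun:
  fixes f g :: "'a::euclidean_space polyfun"
  shows "frechet_derivative (poly_fun (f + g)) (at x) v =
      frechet_derivative (poly_fun f) (at x) v + frechet_derivative (poly_fun g) (at x) v"
    and "frechet_derivative (poly_fun (f * g)) (at x) v =
      poly_fun f x * frechet_derivative (poly_fun g) (at x) v +
      frechet_derivative (poly_fun f) (at x) v * poly_fun g x"
    and "frechet_derivative (poly_fun (c *\<^sub>R 1 :: 'a polyfun)) (at x) v = 0"
    and "frechet_derivative (poly_fun (lform a)) (at x) v = blinfun_apply a v"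
proof -
  have feq: "poly_fun (f + g) = (\<lambda>x. poly_fun f x + poly_fun g x)"
    "poly_fun (f * g) = (\<lambda>x. poly_fun f x * poly_fun g x)"
    "poly_fun (c *\<^sub>R 1 :: 'a polyfun) = (\<lambda>x. c)" "poly_fun (lform a) = blinfun_apply a"
    by (simp_all add: fun_eq_iff)
  show "frechet_derivative (poly_fun (f + g)) (at x) v =
      frechet_derivative (poly_fun f) (at x) v + frechet_derivative (poly_fun g) (at x) v"
    unfolding feq
    by (subst frechet_derivative_at[symmetric, OF has_derivative_add[OF poly_fun_has_derivative poly_fun_has_derivative]]) rule
  show "frechet_derivative (poly_fun (f * g)) (at x) v =
      poly_fun f x * frechet_derivative (poly_fun g) (at x) v +
      frechet_derivative (poly_fun f) (at x) v * poly_fun g x"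
    unfolding feq
    by (subst frechet_derivative_at[symmetric, OF has_derivative_mult[OF poly_fun_has_derivative poly_fun_has_derivative]]) rule
  show "frechet_derivative (poly_fun (c *\<^sub>R 1 :: 'a polyfun)) (at x) v = 0"
    unfolding feq by (subst frechet_derivative_at[symmetric, OF has_derivative_const]) rule
  show "frechet_derivative (poly_fun (lform a)) (at x) v = blinfun_apply a v"
    unfolding feq
    by (subst frechet_derivative_at[symmetric, OF bounded_linear_imp_has_derivative[OF blinfun.bounded_linear_right]]) rule
qed

text \<open>Taking the derivative analytically gives access to the quotient rule and to the
  constancy of functions with zero derivative.\<close>

definition dpoly :: "'a::euclidean_space \<Rightarrow> 'a polyfun \<Rightarrow> 'a polyfun" where
  "dpoly v f = Abs_polyfun (\<lambda>x. frechet_derivative (poly_fun f) (at x) v)"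

lemma poly_fun_dpoly: "poly_fun (dpoly v f) x = frechet_derivative (poly_fun f) (at x) v"
proof -
  have "real_polynomial_function (\<lambda>x. frechet_derivative (poly_fun f) (at x) v)"
    by (induction f rule: polyfun_induct)
       (unfold frechet_derivative_poly_fun,
         use poly_fun in \<open>auto intro!: real_polynomial_function.intros(3) real_polynomial_function.intros(4)\<close>)
  then show ?thesis
    by (simp add: dpoly_def Abs_polyfun_inverse)
qed

lemma dpoly_simps:
  "dpoly v (f + g) = dpoly v f + dpoly v g" "dpoly v (c *\<^sub>R f) = c *\<^sub>R dpoly v f"
  "dpoly v (f * g) = dpoly v f * g + f * dpoly v g"
  "dpoly v (lform a) = blinfun_apply a v *\<^sub>R 1" "dpoly v (c *\<^sub>R 1) = 0"
proof -
  show "dpoly v (c *\<^sub>R f) = c *\<^sub>R dpoly v f"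
    by (rule polyfun_eqI, subst polyfun_scaleR_conv)
       (simp add: poly_fun_dpoly frechet_derivative_poly_fun)
qed (rule polyfun_eqI; unfold poly_fun_dpoly poly_fun_simps frechet_derivative_poly_fun; simp)+

lemma dpoly_linear: "linear (dpoly v)"
  by (rule linearI) (simp_all add: dpoly_simps)

text \<open>Differentiate the scaling law at \<open>x\<close> by the chain rule and cancel one
  factor \<open>c\<close>.\<close>

lemma homogeneous_poly_dpoly:
  assumes "homogeneous_poly (Suc n) f"
  shows "homogeneous_poly n (dpoly v f)"
proof (rule homogeneous_polyI)
  fix c :: real and x assume c: "c \<noteq> 0"
  have "((\<lambda>y. poly_fun f (c *\<^sub>R y)) has_derivative
      (\<lambda>h. frechet_derivative (poly_fun f) (at (c *\<^sub>R x)) (c *\<^sub>R h))) (at x)"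
    by (rule has_derivative_compose[OF _ poly_fun_has_derivative]) (auto intro!: derivative_eq_intros)
  moreover have "(\<lambda>y. poly_fun f (c *\<^sub>R y)) = (\<lambda>y. c ^ Suc n * poly_fun f y)"
    using assms by (auto simp: homogeneous_poly_def)
  moreover have "((\<lambda>y. c ^ Suc n * poly_fun f y) has_derivative
      (\<lambda>h. c ^ Suc n * frechet_derivative (poly_fun f) (at x) h)) (at x)"
    by (intro has_derivative_mult_right poly_fun_has_derivative)
  ultimately have "frechet_derivative (poly_fun f) (at (c *\<^sub>R x)) (c *\<^sub>R v) =
      c ^ Suc n * frechet_derivative (poly_fun f) (at x) v"
    using has_derivative_unique by (metis (no_types, lifting))
  moreover have "frechet_derivative (poly_fun f) (at (c *\<^sub>R x)) (c *\<^sub>R v) =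
      c * frechet_derivative (poly_fun f) (at (c *\<^sub>R x)) v"
    using linear_frechet_derivative[OF differentiable_poly_fun] linear_cmul by fastforce
  ultimately show "poly_fun (dpoly v f) (c *\<^sub>R x) = c ^ n * poly_fun (dpoly v f) x"
    using c by (simp add: poly_fun_dpoly)
qed

text \<open>The quotient of \<open>f\<close> by \<open>g\<close> has vanishing derivative wherever \<open>g\<close> does not vanish.\<close>
lemma polyfun_proportional:
  fixes f g :: "'a::euclidean_space polyfun"
  assumes eq: "\<And>v. g * dpoly v f = f * dpoly v g" and "poly_fun g y \<noteq> 0"
  shows "f = (poly_fun f y / poly_fun g y) *\<^sub>R g"
proof (rule ccontr)
  let ?t = "poly_fun f y / poly_fun g y"
  let ?f' = "\<lambda>x. frechet_derivative (poly_fun f) (at x)" and ?g' = "\<lambda>x. frechet_derivative (poly_fun g) (at x)"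
  assume "f \<noteq> ?t *\<^sub>R g"
  then obtain z where z: "poly_fun (f - ?t *\<^sub>R g) z \<noteq> 0"
    by (metis polyfun_eqI poly_fun_simps(1) right_minus_eq)
  have cont: "continuous (at y) (poly_fun g)"
    using differentiable_imp_continuous_within differentiable_poly_fun by blast
  then obtain e where e: "e > 0" "\<And>x. dist y x < e \<Longrightarrow> poly_fun g x \<noteq> 0"
    using continuous_at_avoid[OF cont \<open>poly_fun g y \<noteq> 0\<close>] by blast
  have "((\<lambda>x. poly_fun f x / poly_fun g x) has_derivative (\<lambda>h. 0)) (at x within ball y e)"
    if "x \<in> ball y e" for x
  proof -
    have gx: "poly_fun g x \<noteq> 0" using e that by (simp add: dist_commute)
    have "poly_fun (g * dpoly v f) x = poly_fun (f * dpoly v g) x" for v using eq by simp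
    then have eqx: "poly_fun g x * ?f' x v = poly_fun f x * ?g' x v" for v
      by (simp add: poly_fun_dpoly)
    have "((\<lambda>x. poly_fun f x / poly_fun g x) has_derivative
      (\<lambda>h. - poly_fun f x * (inverse (poly_fun g x) * ?g' x h * inverse (poly_fun g x)) +
           ?f' x h / poly_fun g x)) (at x)"
      by (rule has_derivative_divide[OF poly_fun_has_derivative poly_fun_has_derivative gx])
    moreover have "- poly_fun f x * (inverse (poly_fun g x) * ?g' x h * inverse (poly_fun g x)) +
           ?f' x h / poly_fun g x = 0" for h
      using eqx[of h] gx by (simp add: field_simps)
    ultimately show ?thesis
      by (simp add: has_derivative_at_withinI)
  qed
  then obtain c where c: "\<And>x. x \<in> ball y e \<Longrightarrow> poly_fun f x / poly_fun g x = c"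
    using has_derivative_zero_constant[OF convex_ball, of y e "\<lambda>x. poly_fun f x / poly_fun g x"] by blast
  have "poly_fun (f - ?t *\<^sub>R g) x = 0" if "x \<in> ball y e" for x
  proof -
    have "poly_fun f x / poly_fun g x = ?t" using c[OF that] c[of y] e(1) by simp
    then show ?thesis using e(2)[of x] that by (simp add: field_simps)
  qed
  \<comment> \<open>The identity holds so far only on a ball. The line from \<open>y\<close> to
    \<open>z\<close> has infinitely many parameters in it, which carries the identity to
    \<open>z\<close> at parameter 1; the \<open>+ 1\<close> keeps the denominator positive.\<close>
  then have van: "poly_fun (f - ?t *\<^sub>R g) (y + t *\<^sub>R (z - y)) = 0"
    if "t \<in> {0<..<e / (norm (z - y) + 1)}" for t
  proof -
    have "norm (t *\<^sub>R (z - y)) \<le> t * (norm (z - y) + 1)" using that by simp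
    also have "\<dots> < e" using that by (simp add: field_simps add_pos_nonneg)
    finally show ?thesis
      using \<open>\<And>x. x \<in> ball y e \<Longrightarrow> poly_fun (f - ?t *\<^sub>R g) x = 0\<close> by (simp add: dist_norm)
  qed
  have "0 < e / (norm (z - y) + 1)"
    using e by (simp add: add_nonneg_pos)
  then have "infinite {0<..<e / (norm (z - y) + 1)}"
    by (simp add: infinite_Ioo)
  then have "infinite {t. poly_fun (f - ?t *\<^sub>R g) (y + t *\<^sub>R (z - y)) = 0}"
    by (rule infinite_super[rotated]) (intro subsetI CollectI van)
  from real_polynomial_function_infinite_zeros[OF real_polynomial_function_line this, of 1]
  show False using z by simp
qed

lemma blinfun_inner_expansion:
  fixes a :: "'a::euclidean_space \<Rightarrow>\<^sub>L real"
  shows "a = (\<Sum>b\<in>Basis. blinfun_apply a b *\<^sub>R blinfun_inner_left b)"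
proof (rule blinfun_eqI)
  fix x
  have "blinfun_apply a x = blinfun_apply a (\<Sum>b\<in>Basis. (x \<bullet> b) *\<^sub>R b)"
    by (simp add: euclidean_representation)
  then show "blinfun_apply a x =
      blinfun_apply (\<Sum>b\<in>Basis. blinfun_apply a b *\<^sub>R blinfun_inner_left b) x"
    by (simp add: blinfun.bilinear_simps blinfun.sum_right blinfun.sum_left mult.commute inner_commute)
qed

section \<open>Derivations and their values on linear forms\<close>

lemma Der_one: "\<theta> \<in> Der \<Longrightarrow> \<theta> 1 = 0"
proof -
  assume "\<theta> \<in> Der"
  then have "\<theta> (1 * 1) = \<theta> 1 * 1 + 1 * \<theta> 1" unfolding Der_def by blast
  then have "\<theta> 1 = \<theta> 1 + \<theta> 1" unfolding mult_1_left mult_1_right .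
  then show "\<theta> 1 = 0" by (metis add_cancel_right_right)
qed

lemma Der_eqI:
  assumes "\<theta> \<in> Der" "\<theta>' \<in> Der" "\<And>a. \<theta> (lform a) = \<theta>' (lform a)"
  shows "\<theta> = \<theta>'"
proof
  have lin: "linear \<theta>" "linear \<theta>'" using assms by (auto simp: Der_def)
  fix f show "\<theta> f = \<theta>' f"
  proof (induction f rule: polyfun_induct)
    case (const c)
    show ?case using Der_one[OF assms(1)] Der_one[OF assms(2)] lin by (simp add: linear_cmul)
  next
    case (mult f g)
    then show ?case using assms(1,2) by (simp add: Der_def)
  qed (use assms(3) lin in \<open>auto simp: linear_add\<close>)
qed

text \<open>Weight the partial derivatives by the values prescribed on the coordinate forms.\<close>

lemma Der_extend:
  fixes g :: "('a::euclidean_space \<Rightarrow>\<^sub>L real) \<Rightarrow> 'a polyfun"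
  assumes "linear g"
  obtains \<theta> where "\<theta> \<in> Der" "\<And>a. \<theta> (lform a) = g a"
proof
  let ?\<theta> = "\<lambda>f. \<Sum>b\<in>Basis. dpoly b f * g (blinfun_inner_left b)"
  show "?\<theta> \<in> Der"
    unfolding Der_def
    by (auto intro!: linearI simp: dpoly_simps polyfun_scaleR_mult sum.distrib scaleR_sum_right
        sum_distrib_left sum_distrib_right algebra_simps)
  fix a
  have "g a = (\<Sum>b\<in>Basis. blinfun_apply a b *\<^sub>R g (blinfun_inner_left b))"
    by (subst blinfun_inner_expansion) (simp add: linear_sum[OF assms] linear_cmul[OF assms])
  then show "?\<theta> (lform a) = g a"
    by (simp add: dpoly_simps polyfun_scaleR_mult)
qed

section \<open>Reflections\<close>

lemma riesz_linear: "linear (riesz :: ('a::euclidean_space \<Rightarrow>\<^sub>L real) \<Rightarrow> 'a)"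
  by (rule linearI)
     (simp_all add: riesz_def blinfun.bilinear_simps sum.distrib scaleR_add_left scaleR_sum_right)

lemma dual_inner_conv: "dual_inner a b = blinfun_apply a (riesz b)"
  by (simp add: dual_inner_def riesz_inner)

lemma dual_inner_commute: "dual_inner a b = dual_inner b a"
  by (simp add: dual_inner_def inner_commute)

lemma dual_inner_self_eq_0 [simp]: "dual_inner a a = 0 \<longleftrightarrow> a = 0"
proof
  assume "dual_inner a a = 0"
  then have "riesz a = 0" by (simp add: dual_inner_def)
  then show "a = 0" by (metis blinfun_eqI inner_zero_left riesz_inner zero_blinfun.rep_eq)
qed (simp add: dual_inner_conv)

lemma dual_reflection_apply: "blinfun_apply (dual_reflection \<gamma> a) x = blinfun_apply a (blinfun_apply (reflection \<gamma>) x)"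
  by (simp add: dual_reflection_def reflection_apply blinfun.bilinear_simps dual_inner_conv)

lemma dual_reflection_conv: "dual_reflection \<gamma> a = a o\<^sub>L reflection \<gamma>"
  by (rule blinfun_eqI) (simp add: dual_reflection_apply)

lemma dual_reflection_linear: "linear (dual_reflection \<gamma>)"
  by (rule linearI; rule blinfun_eqI) (simp_all add: dual_reflection_apply blinfun.bilinear_simps)

lemma dual_reflection_involution: "\<gamma> \<noteq> 0 \<Longrightarrow> dual_reflection \<gamma> (dual_reflection \<gamma> a) = a"
  by (rule blinfun_eqI) (simp add: dual_reflection_apply reflection_involution)

lemma dual_reflection_self: "\<gamma> \<noteq> 0 \<Longrightarrow> dual_reflection \<gamma> \<gamma> = - \<gamma>"
  by (simp add: dual_reflection_def scaleR_2)

lemma pullback_reflection_lform: "pullback (reflection \<gamma>) (lform a) = lform (dual_reflection \<gamma> a)"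
  by (simp add: pullback_simps dual_reflection_conv)

lemma pullback_reflection_involution:
  "\<gamma> \<noteq> 0 \<Longrightarrow> pullback (reflection \<gamma>) (pullback (reflection \<gamma>) f) = f"
  by (rule polyfun_eqI) (simp add: reflection_involution)

lemma pullback_reflection_eq_0_iff: "\<gamma> \<noteq> 0 \<Longrightarrow> pullback (reflection \<gamma>) f = 0 \<longleftrightarrow> f = 0"
  by (metis pullback_reflection_involution pullback_simps(6))

text \<open>The reflection fixes the kernel of \<open>\<gamma>\<close> pointwise, so the difference
  vanishes there.\<close>

lemma lform_dvd_diff_reflection:
  assumes "\<gamma> \<noteq> 0"
  shows "lform \<gamma> dvd f - pullback (reflection \<gamma>) f"
  unfolding lform_dvd_iff[OF assms] by (simp add: reflection_apply)

lemma linear_blinfun_inner_left: "linear (blinfun_inner_left :: 'a::euclidean_space \<Rightarrow> _)"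
  using bounded_linear_blinfun_inner_left bounded_linear.linear by blast

section \<open>Multiderivations in low degree\<close>

text \<open>
  A derivation is determined by its values on linear forms, which can be prescribed linearly, so
  the module of multiderivations is encoded by linear maps from \<open>V\<^sup>*\<close> to \<open>S(V\<^sup>*)\<close>.
\<close>
definition multi_fields ::
    "('a::euclidean_space \<Rightarrow>\<^sub>L real) set \<Rightarrow> nat \<Rightarrow> nat \<Rightarrow> (('a \<Rightarrow>\<^sub>L real) \<Rightarrow> 'a polyfun) set" where
  "multi_fields P m n =
     {g. linear g \<and> (\<forall>a. homogeneous_poly n (g a)) \<and> (\<forall>\<beta>\<in>P. lform \<beta> ^ m dvd g \<beta>)}"

lemma multi_fields_derivation_exists:
  assumes "g \<in> multi_fields P m n"
  obtains \<theta> where "\<theta> \<in> degree_part (multi_derivations P m) n" "\<And>a. \<theta> (lform a) = g a"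
proof -
  obtain \<theta> where "\<theta> \<in> Der" "\<And>a. \<theta> (lform a) = g a"
    using Der_extend[of g] assms by (auto simp: multi_fields_def)
  then show ?thesis
    using that assms by (auto simp: multi_fields_def degree_part_def multi_derivations_def)
qed

lemma multi_fields_lform_mult:
  assumes "g \<in> multi_fields P m n"
  shows "(\<lambda>a. lform l * g a) \<in> multi_fields P m (Suc n)"
  using assms
  by (auto simp: multi_fields_def intro!: linearI homogeneous_poly_lform_mult
      simp: linear_add linear_cmul polyfun_scaleR_mult algebra_simps)

text \<open>Degree \<open>n + 1\<close> is parametrized linearly by a space of dimension
  \<open>DIM('a)\<close>, and the products of the nonzero \<open>F\<close> with linear forms already
  have that dimension.\<close>

lemma multi_fields_eq_lform_mult:
  fixes \<Xi> :: "'a::euclidean_space \<Rightarrow> ('a \<Rightarrow>\<^sub>L real) \<Rightarrow> 'a polyfun"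
  assumes lin: "\<And>a. linear (\<lambda>v. \<Xi> v a)" and sub: "multi_fields P m (Suc n) \<subseteq> range \<Xi>"
    and F: "F \<in> multi_fields P m n" and nz: "F a0 \<noteq> 0" and G: "G \<in> multi_fields P m (Suc n)"
  obtains l where "\<And>a. G a = lform l * F a"
proof -
  have "\<exists>v. \<forall>a. lform (blinfun_inner_left b) * F a = \<Xi> v a" for b
    using multi_fields_lform_mult[OF F, of "blinfun_inner_left b"] sub by (force simp: fun_eq_iff image_def)
  then obtain v where v: "\<And>b a. lform (blinfun_inner_left b) * F a = \<Xi> (v b) a" by metis
  \<comment> \<open>\<open>L x\<close> is a parameter of the product of \<open>F\<close> with the
    form \<open>x \<bullet> _\<close>; injectivity of \<open>L\<close> makes it onto.\<close>
  define L where "L x = (\<Sum>b\<in>Basis. (x \<bullet> b) *\<^sub>R v b)" for x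
  have linL: "linear L"
    by (rule linearI) (simp_all add: L_def inner_add_left scaleR_add_left sum.distrib scaleR_sum_right)
  have L: "\<Xi> (L x) a = lform (blinfun_inner_left x) * F a" for x a
  proof -
    have "\<Xi> (L x) a = (\<Sum>b\<in>Basis. (x \<bullet> b) *\<^sub>R (lform (blinfun_inner_left b) * F a))"
      by (simp add: L_def linear_sum[OF lin] linear_cmul[OF lin] v)
    also have "\<dots> = lform (blinfun_inner_left (\<Sum>b\<in>Basis. (x \<bullet> b) *\<^sub>R b)) * F a"
      by (simp add: linear_sum[OF linear_blinfun_inner_left] linear_cmul[OF linear_blinfun_inner_left]
          linear_sum[OF linear_lform] lform_linear sum_distrib_right polyfun_scaleR_mult
          del: euclidean_representation)
    finally show ?thesis by (simp add: euclidean_representation)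
  qed
  have "inj L"
  proof (rule linear_injective_0[THEN iffD2, OF linL], intro allI impI)
    fix x assume "L x = 0"
    then have "lform (blinfun_inner_left x) * F a0 = 0"
      using L[of x a0] linear_0[OF lin] by simp
    then have "blinfun_inner_left x = (0 :: 'a \<Rightarrow>\<^sub>L real)" using nz by simp
    then have "blinfun_apply (blinfun_inner_left x) x = 0" by simp
    then show "x = 0" by simp
  qed
  then have "surj L" using linL linear_injective_imp_surjective by blast
  moreover obtain u where "G = \<Xi> u" using G sub by blast
  ultimately obtain x where "G = \<Xi> (L x)" by (metis surjD)
  then show ?thesis using that L by metis
qed

lemma DIM_ge_2_obtain:
  assumes "2 \<le> DIM('a::euclidean_space)"
  obtains b1 b2 :: "'a::euclidean_space" where "b1 \<in> Basis" "b2 \<in> Basis" "b1 \<noteq> b2" "b1 \<bullet> b2 = 0"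
proof -
  obtain b1 b2 :: 'a where "b1 \<in> Basis" "b2 \<in> Basis" "b1 \<noteq> b2"
    using assms by (metis card_le_Suc0_iff_eq finite_Basis not_less_eq_eq numeral_2_eq_2)
  then show ?thesis using that inner_not_same_Basis by blast
qed

text \<open>Both \<open>l1 G\<close> and \<open>l2 G\<close> are multiples \<open>l1' F\<close> and
  \<open>l2' F\<close>. Hence \<open>l2 l1' = l1 l2'\<close>; the prime \<open>l1\<close> does not
  divide \<open>l2\<close>, so it divides \<open>l1'\<close> and cancels.\<close>

lemma multi_fields_proportional:
  fixes \<Xi> :: "'a::euclidean_space \<Rightarrow> ('a \<Rightarrow>\<^sub>L real) \<Rightarrow> 'a polyfun"
  assumes lin: "\<And>a. linear (\<lambda>v. \<Xi> v a)" and sub: "multi_fields P m (Suc n) \<subseteq> range \<Xi>"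
    and dim: "2 \<le> DIM('a)"
    and F: "F \<in> multi_fields P m n" and nz: "F a0 \<noteq> 0" and G: "G \<in> multi_fields P m n"
  obtains c where "\<And>a. G a = c *\<^sub>R F a"
proof -
  obtain b1 b2 :: 'a where b: "b1 \<in> Basis" "b2 \<in> Basis" "b1 \<noteq> b2" "b1 \<bullet> b2 = 0"
    using DIM_ge_2_obtain[OF dim] by blast
  define l1 where "l1 = (blinfun_inner_left b1 :: 'a \<Rightarrow>\<^sub>L real)"
  define l2 where "l2 = (blinfun_inner_left b2 :: 'a \<Rightarrow>\<^sub>L real)"
  have app: "blinfun_apply l1 b1 = 1" "blinfun_apply l1 b2 = 0" "blinfun_apply l2 b2 = 1"
    using b by (simp_all add: l1_def l2_def inner_commute)
  then have l1: "l1 \<noteq> 0" by auto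
  obtain l1' where l1': "\<And>a. lform l1 * G a = lform l1' * F a"
    using multi_fields_eq_lform_mult[OF lin sub F nz multi_fields_lform_mult[OF G, of l1]] by blast
  obtain l2' where l2': "\<And>a. lform l2 * G a = lform l2' * F a"
    using multi_fields_eq_lform_mult[OF lin sub F nz multi_fields_lform_mult[OF G, of l2]] by blast
  have "lform l1 * (lform l2' * F a0) = lform l2 * (lform l1' * F a0)"
    by (simp flip: l1' l2' add: ac_simps)
  then have "lform l2 * lform l1' = lform l1 * lform l2'"
    using nz by (simp add: mult.assoc[symmetric])
  then have "lform l1 dvd lform l2 * lform l1'" by simp
  moreover have "\<not> lform l1 dvd lform l2"
    using app lform_dvd_iff[OF l1] by force
  ultimately have "lform l1 dvd lform l1'"
    using prime_elem_lform[OF l1] prime_elem_dvd_multD by blast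
  then obtain c where "l1' = c *\<^sub>R l1"
    using lform_dvd_lform_iff[OF l1] by blast
  then have "lform l1 * G a = lform l1 * (c *\<^sub>R F a)" for a
    using l1' by (simp add: lform_linear polyfun_scaleR_mult)
  then have "G a = c *\<^sub>R F a" for a using l1 by simp
  then show ?thesis by (rule that)
qed

text \<open>For nonzero \<open>G\<close> the products with two independent linear forms would be
  proportional one degree higher.\<close>

lemma multi_fields_two_below:
  fixes \<Xi> :: "'a::euclidean_space \<Rightarrow> ('a \<Rightarrow>\<^sub>L real) \<Rightarrow> 'a polyfun"
  assumes lin: "\<And>a. linear (\<lambda>v. \<Xi> v a)" and sub: "multi_fields P m (Suc (Suc n)) \<subseteq> range \<Xi>"
    and dim: "2 \<le> DIM('a)" and G: "G \<in> multi_fields P m n"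
  shows "G a = 0"
proof (rule ccontr)
  assume nz: "G a \<noteq> 0"
  obtain b1 b2 :: 'a where b: "b1 \<in> Basis" "b2 \<in> Basis" "b1 \<noteq> b2" "b1 \<bullet> b2 = 0"
    using DIM_ge_2_obtain[OF dim] by blast
  define l1 where "l1 = (blinfun_inner_left b1 :: 'a \<Rightarrow>\<^sub>L real)"
  define l2 where "l2 = (blinfun_inner_left b2 :: 'a \<Rightarrow>\<^sub>L real)"
  have app: "blinfun_apply l1 b1 = 1" "blinfun_apply l1 b2 = 0" "blinfun_apply l2 b2 = 1"
    using b by (simp_all add: l1_def l2_def inner_commute)
  have nz1: "lform l1 * G a \<noteq> 0" using nz app by auto
  obtain c where "\<And>a. lform l2 * G a = c *\<^sub>R (lform l1 * G a)"
    by (rule multi_fields_proportional[OF lin sub dim multi_fields_lform_mult[OF G, of l1] nz1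
          multi_fields_lform_mult[OF G, of l2]]) (rule that)
  then have "lform l2 * G a = lform (c *\<^sub>R l1) * G a" for a by (simp add: lform_linear polyfun_scaleR_mult)
  then have "l2 = c *\<^sub>R l1" using nz mult_right_cancel lform_eq_iff by blast
  then have "blinfun_apply l2 b2 = c * blinfun_apply l1 b2" by (simp add: blinfun.bilinear_simps)
  then show False using app by simp
qed

section \<open>Reflected fields and Dunkl operators\<close>

lemma root_system_reflection:
  "root_system \<Phi> \<Longrightarrow> \<gamma> \<in> \<Phi> \<Longrightarrow> \<beta> \<in> \<Phi> \<Longrightarrow> dual_reflection \<gamma> \<beta> \<in> \<Phi>"
  by (auto simp: root_system_def)

lemma root_system_nonzero: "root_system \<Phi> \<Longrightarrow> \<beta> \<in> \<Phi> \<Longrightarrow> \<beta> \<noteq> 0"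
  by (auto simp: root_system_def)

lemma linear_root_system_eq_0:
  assumes "root_system \<Phi>" "linear g" "\<And>\<beta>. \<beta> \<in> \<Phi> \<Longrightarrow> g \<beta> = 0"
  shows "g a = 0"
proof -
  have "a \<in> span \<Phi>" using assms(1) by (auto simp: root_system_def)
  then show ?thesis using linear_eq_0_on_span[OF assms(2)] assms(3) by blast
qed

definition positive_half :: "('a::euclidean_space \<Rightarrow>\<^sub>L real) set \<Rightarrow> ('a \<Rightarrow>\<^sub>L real) set \<Rightarrow> bool" where
  "positive_half \<Phi> P \<longleftrightarrow> \<Phi> = P \<union> uminus ` P \<and> (\<forall>\<beta>\<in>P. - \<beta> \<notin> P)"

text \<open>Divisibility makes the roots proportional; reducedness leaves only a sign, and
  \<open>P\<close> contains no opposite pair.\<close>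

lemma positive_half_not_dvd:
  assumes "root_system \<Phi>" "positive_half \<Phi> P" "\<beta> \<in> P" "\<gamma> \<in> P" "\<beta> \<noteq> \<gamma>"
  shows "\<not> lform \<beta> dvd lform \<gamma>"
proof
  have \<Phi>: "\<beta> \<in> \<Phi>" "\<gamma> \<in> \<Phi>" using assms by (auto simp: positive_half_def)
  assume "lform \<beta> dvd lform \<gamma>"
  then obtain c where c: "\<gamma> = c *\<^sub>R \<beta>"
    using lform_dvd_lform_iff root_system_nonzero[OF assms(1)] \<Phi> by blast
  then have "c = 1 \<or> c = -1" using \<Phi> assms(1) unfolding root_system_def by blast
  then show False using c assms by (auto simp: positive_half_def)
qed

text \<open>Even powers are insensitive to the choice of sign, hence the condition extends from \<open>P\<close> to \<open>\<Phi>\<close>.\<close>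
lemma multi_fields_root_dvd:
  assumes "positive_half \<Phi> P" "g \<in> multi_fields P (2 * k) n" "\<beta> \<in> \<Phi>"
  shows "lform \<beta> ^ (2 * k) dvd g \<beta>"
proof (cases "\<beta> \<in> P")
  case False
  then have "- \<beta> \<in> P" using assms by (auto simp: positive_half_def)
  moreover have "linear g" using assms(2) by (simp add: multi_fields_def)
  ultimately have "lform (- \<beta>) ^ (2 * k) dvd - g \<beta>"
    using assms(2) by (auto simp: multi_fields_def linear_neg dest!: bspec)
  then show ?thesis by (simp add: lform_linear)
qed (use assms in \<open>simp add: multi_fields_def\<close>)

text \<open>The action of a reflection on a derivation, expressed on values at linear forms; compare
  \<open>der_act_reflection\<close>.\<close>

definition reflect_field ::
    "('a::euclidean_space \<Rightarrow>\<^sub>L real) \<Rightarrow> (('a \<Rightarrow>\<^sub>L real) \<Rightarrow> 'a polyfun) \<Rightarrow> ('a \<Rightarrow>\<^sub>L real) \<Rightarrow> 'a polyfun" where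
  "reflect_field \<gamma> g a = pullback (reflection \<gamma>) (g (dual_reflection \<gamma> a))"

lemma reflect_field_linear: "linear g \<Longrightarrow> linear (reflect_field \<gamma> g)"
  by (rule linearI)
     (simp_all add: reflect_field_def linear_add[OF dual_reflection_linear]
       linear_cmul[OF dual_reflection_linear] linear_add linear_cmul pullback_simps)

text \<open>The reflection permutes \<Phi>, and the divisibility conditions hold at negative roots
  as well.\<close>

lemma reflect_field_multi_fields:
  assumes "root_system \<Phi>" "positive_half \<Phi> P" "g \<in> multi_fields P (2 * k) n" "\<gamma> \<in> \<Phi>"
  shows "reflect_field \<gamma> g \<in> multi_fields P (2 * k) n"
  unfolding multi_fields_def
proof (intro CollectI conjI allI ballI)
  have g: "linear g" "\<And>a. homogeneous_poly n (g a)" using assms(3) by (auto simp: multi_fields_def)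
  show "linear (reflect_field \<gamma> g)" using g reflect_field_linear by blast
  show "homogeneous_poly n (reflect_field \<gamma> g a)" for a
    by (simp add: reflect_field_def homogeneous_poly_pullback g)
  fix \<beta> assume "\<beta> \<in> P"
  then have \<beta>: "\<beta> \<in> \<Phi>" using assms by (auto simp: positive_half_def)
  let ?\<beta> = "dual_reflection \<gamma> \<beta>"
  have "pullback (reflection \<gamma>) (lform ?\<beta> ^ (2 * k)) dvd pullback (reflection \<gamma>) (g ?\<beta>)"
    using multi_fields_root_dvd assms root_system_reflection \<beta> by (intro pullback_dvd) blast
  then show "lform \<beta> ^ (2 * k) dvd reflect_field \<gamma> g \<beta>"
    using root_system_nonzero[OF assms(1,4)]
    by (simp add: reflect_field_def pullback_simps(8) pullback_reflection_lform dual_reflection_involution)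
qed

text \<open>On the kernel of \<open>\<gamma>\<close> the reflection fixes points, and the reflected
  argument differs from \<open>a\<close> by a multiple of \<open>\<gamma>\<close>, whose value under
  \<open>g\<close> vanishes there.\<close>

lemma root_dvd_reflect_field_diff:
  assumes "\<gamma> \<noteq> 0" "linear g" "lform \<gamma> dvd g \<gamma>"
  shows "lform \<gamma> dvd g a - reflect_field \<gamma> g a"
proof -
  obtain c where c: "dual_reflection \<gamma> a = a - c *\<^sub>R \<gamma>" unfolding dual_reflection_def by blast
  have "poly_fun (g \<gamma>) x = 0" if "blinfun_apply \<gamma> x = 0" for x
    using assms that lform_dvd_iff by blast
  then show ?thesis
    unfolding lform_dvd_iff[OF assms(1)]
    by (simp add: reflect_field_def reflection_apply c linear_diff[OF assms(2)] linear_cmul[OF assms(2)])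
qed

text \<open>The divided difference of the Dunkl operator; the choice is meaningful whenever
  \<open>root_dvd_reflect_field_diff\<close> applies.\<close>

definition root_quotient ::
    "('a::euclidean_space \<Rightarrow>\<^sub>L real) \<Rightarrow> (('a \<Rightarrow>\<^sub>L real) \<Rightarrow> 'a polyfun) \<Rightarrow> ('a \<Rightarrow>\<^sub>L real) \<Rightarrow> 'a polyfun" where
  "root_quotient \<gamma> g a = (SOME q. g a - reflect_field \<gamma> g a = lform \<gamma> * q)"

lemma root_quotient:
  assumes "\<gamma> \<noteq> 0" "linear g" "lform \<gamma> dvd g \<gamma>"
  shows "lform \<gamma> * root_quotient \<gamma> g a = g a - reflect_field \<gamma> g a"
  unfolding root_quotient_def
  using someI_ex[of "\<lambda>q. g a - reflect_field \<gamma> g a = lform \<gamma> * q"]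
    root_dvd_reflect_field_diff[OF assms, of a] by (auto simp: dvd_def)

text \<open>Quotients are chosen separately for each argument, so linearity is recovered by
  cancelling the form.\<close>

lemma lform_mult_eq_linear:
  assumes "l \<noteq> 0" "linear h" "\<And>a. lform l * q a = h a"
  shows "linear q"
proof (rule linearI)
  fix a b c
  have "lform l * q (a + b) = lform l * (q a + q b)" "lform l * q (c *\<^sub>R a) = lform l * (c *\<^sub>R q a)"
    by (simp_all add: assms(3) distrib_left polyfun_scaleR_mult linear_add[OF assms(2)] linear_cmul[OF assms(2)])
  then show "q (a + b) = q a + q b" "q (c *\<^sub>R a) = c *\<^sub>R q a"
    using assms(1) by simp_all
qed

text \<open>
  The Dunkl operator \<open>T\<^sub>v\<close> with parameter \<open>k\<close>, acting on derivations.  At the root \<open>\<beta>\<close> the two terms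
  of order \<open>2k - 1\<close> in \<open>\<beta>\<close> combine to \<open>k \<beta>(v) \<beta>\<^bsup>2k-1\<^esup> (h - s\<^sub>\<beta>h)\<close>, which gains one more order.
\<close>
definition dunkl ::
    "('a::euclidean_space \<Rightarrow>\<^sub>L real) set \<Rightarrow> nat \<Rightarrow> 'a \<Rightarrow> (('a \<Rightarrow>\<^sub>L real) \<Rightarrow> 'a polyfun) \<Rightarrow>
     ('a \<Rightarrow>\<^sub>L real) \<Rightarrow> 'a polyfun" where
  "dunkl P k v g a =
     dpoly v (g a) - (\<Sum>\<gamma>\<in>P. (real k * blinfun_apply \<gamma> v) *\<^sub>R root_quotient \<gamma> g a)"

lemma dpoly_power_mult:
  "dpoly v (lform b ^ Suc m * h) =
     (real (Suc m) * blinfun_apply b v) *\<^sub>R (lform b ^ m * h) + lform b ^ Suc m * dpoly v h"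
proof -
  have "dpoly v (lform b ^ m) = (real m * blinfun_apply b v) *\<^sub>R (lform b ^ (m - 1))" for m
  proof (induction m)
    case 0
    show ?case using dpoly_simps(5)[of v 1] by simp
  next
    case (Suc m)
    have "dpoly v (lform b ^ Suc m) = blinfun_apply b v *\<^sub>R lform b ^ m +
        (real m * blinfun_apply b v) *\<^sub>R (lform b * lform b ^ (m - 1))"
      unfolding power_Suc dpoly_simps(3,4) Suc by (simp add: polyfun_scaleR_mult)
    also have "(real m * blinfun_apply b v) *\<^sub>R (lform b * lform b ^ (m - 1)) =
        (real m * blinfun_apply b v) *\<^sub>R lform b ^ m"
      by (cases m) simp_all
    also have "blinfun_apply b v *\<^sub>R lform b ^ m + (real m * blinfun_apply b v) *\<^sub>R lform b ^ m =
        (real (Suc m) * blinfun_apply b v) *\<^sub>R lform b ^ (Suc m - 1)"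
      by (simp only: scaleR_add_left[symmetric] of_nat_Suc distrib_right mult_1_left diff_Suc_1 add.commute)
    finally show ?case .
  qed
  from this[of "Suc m"] show ?thesis
    by (simp add: dpoly_simps(3) polyfun_scaleR_mult)
qed

lemma dunkl_multi_fields:
  assumes root: "root_system \<Phi>" and half: "positive_half \<Phi> P" and k: "k \<ge> 1"
    and g: "g \<in> multi_fields P (2 * k) (Suc n)"
  shows "dunkl P k v g \<in> multi_fields P (2 * k) n"
proof -
  have fin: "finite P" using root half by (auto simp: root_system_def positive_half_def)
  have P\<Phi>: "P \<subseteq> \<Phi>" using half by (auto simp: positive_half_def)
  have nz: "\<gamma> \<noteq> 0" if "\<gamma> \<in> P" for \<gamma> using that P\<Phi> root_system_nonzero[OF root] by blast
  have lin: "linear g" and hom: "\<And>a. homogeneous_poly (Suc n) (g a)"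
    and dvd: "\<And>\<beta>. \<beta> \<in> P \<Longrightarrow> lform \<beta> ^ (2 * k) dvd g \<beta>" using g by (auto simp: multi_fields_def)
  obtain m where m: "2 * k = Suc m" using k by (cases "2 * k") auto
  have dvd1: "lform \<gamma> dvd g \<gamma>" if "\<gamma> \<in> P" for \<gamma>
    using dvd[OF that] unfolding m by (auto simp: dvd_def mult.assoc)
  have q: "lform \<gamma> * root_quotient \<gamma> g a = g a - reflect_field \<gamma> g a" if "\<gamma> \<in> P" for \<gamma> a
    using root_quotient[OF nz[OF that] lin dvd1[OF that]] .
  have refl: "reflect_field \<gamma> g \<in> multi_fields P (2 * k) (Suc n)" if "\<gamma> \<in> P" for \<gamma>
    using reflect_field_multi_fields[OF root half g] that P\<Phi> by blast
  have linq: "linear (root_quotient \<gamma> g)" if "\<gamma> \<in> P" for \<gamma>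
    by (rule lform_mult_eq_linear[OF nz[OF that] _ q[OF that]])
       (intro linear_compose_sub lin reflect_field_linear)
  have homq: "homogeneous_poly n (root_quotient \<gamma> g a)" if "\<gamma> \<in> P" for \<gamma> a
  proof (rule homogeneous_poly_lform_cancel[OF _ nz[OF that]])
    show "homogeneous_poly (Suc n) (lform \<gamma> * root_quotient \<gamma> g a)"
      using q[OF that] hom refl[OF that] by (auto simp: multi_fields_def intro: homogeneous_poly_diff)
  qed
  have "linear (dunkl P k v g)"
    unfolding dunkl_def
    by (intro linear_compose_sub linear_compose_sum ballI linear_compose_scale_right linq)
       (use linear_compose[OF lin dpoly_linear[of v]] in \<open>simp_all add: o_def\<close>)
  moreover have "homogeneous_poly n (dunkl P k v g a)" for a
    unfolding dunkl_def
    by (intro homogeneous_poly_diff homogeneous_poly_sum homogeneous_poly_scaleR homq homogeneous_poly_dpoly hom)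
  moreover have "lform \<beta> ^ (2 * k) dvd dunkl P k v g \<beta>" if \<beta>: "\<beta> \<in> P" for \<beta>
  proof -
    let ?s = "pullback (reflection \<beta>)"
    \<comment> \<open>Both \<open>g \<beta>\<close> and its reflected counterpart contain the full
      power of \<open>\<beta>\<close>, and dividing by the coprime \<open>\<gamma>\<close> preserves
      it.\<close>
    have other: "lform \<beta> ^ (2 * k) dvd root_quotient \<gamma> g \<beta>" if \<gamma>: "\<gamma> \<in> P - {\<beta>}" for \<gamma>
    proof (rule prime_elem_power_dvd_mult)
      show "prime_elem (lform \<beta>)" using prime_elem_lform nz \<beta> by blast
      show "\<not> lform \<beta> dvd lform \<gamma>" using positive_half_not_dvd[OF root half \<beta>, of \<gamma>] \<gamma> by auto
      show "lform \<beta> ^ (2 * k) dvd lform \<gamma> * root_quotient \<gamma> g \<beta>"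
        using q[of \<gamma> \<beta>] dvd[OF \<beta>] refl[of \<gamma>] \<gamma> \<beta> by (auto simp: multi_fields_def)
    qed
    obtain h where h: "g \<beta> = lform \<beta> ^ Suc m * h" using dvd[OF \<beta>] unfolding m by (auto simp: dvd_def)
    \<comment> \<open>The exponent \<open>2k\<close> is even, so the only sign comes from the
      argument \<open>- \<beta>\<close>; it causes the plus sign in \<open>h + ?s h\<close>.\<close>
    have "reflect_field \<beta> g \<beta> = - (?s (lform \<beta> ^ Suc m * h))"
      by (simp add: reflect_field_def dual_reflection_self nz \<beta> linear_neg[OF lin] pullback_simps h)
    also have "\<dots> = - (lform \<beta> ^ Suc m * ?s h)"
      using nz[OF \<beta>]
      by (simp add: pullback_simps(4,8) pullback_reflection_lform dual_reflection_self lform_linear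
          del: power_Suc flip: m)
    finally have "lform \<beta> * root_quotient \<beta> g \<beta> = lform \<beta> * (lform \<beta> ^ m * (h + ?s h))"
      using q[OF \<beta>, of \<beta>] h by (simp add: algebra_simps)
    then have q\<beta>: "root_quotient \<beta> g \<beta> = lform \<beta> ^ m * (h + ?s h)" using nz[OF \<beta>] by simp
    have "real (Suc m) = 2 * real k" using m by linarith
    then have "dpoly v (g \<beta>) - (real k * blinfun_apply \<beta> v) *\<^sub>R root_quotient \<beta> g \<beta> =
        (real k * blinfun_apply \<beta> v) *\<^sub>R (lform \<beta> ^ m * (h - ?s h)) + lform \<beta> ^ Suc m * dpoly v h"
      unfolding h dpoly_power_mult q\<beta>
      by (simp add: polyfun_scaleR_mult distrib_left right_diff_distrib scaleR_add_right scaleR_diff_right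
          mult.assoc scaleR_2 flip: scaleR_scaleR)
    moreover have "lform \<beta> ^ Suc m dvd lform \<beta> ^ m * (h - ?s h)"
      using lform_dvd_diff_reflection[OF nz[OF \<beta>], of h]
      by (metis mult.commute mult_dvd_mono dvd_refl power_Suc)
    ultimately have "lform \<beta> ^ (2 * k) dvd
        dpoly v (g \<beta>) - (real k * blinfun_apply \<beta> v) *\<^sub>R root_quotient \<beta> g \<beta>"
      unfolding m by (simp del: power_Suc add: polyfun_dvd_scaleR)
    moreover have "dunkl P k v g \<beta> =
        (dpoly v (g \<beta>) - (real k * blinfun_apply \<beta> v) *\<^sub>R root_quotient \<beta> g \<beta>) -
        (\<Sum>\<gamma>\<in>P - {\<beta>}. (real k * blinfun_apply \<gamma> v) *\<^sub>R root_quotient \<gamma> g \<beta>)"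
      unfolding dunkl_def by (simp add: sum.remove[OF fin \<beta>])
    moreover have "lform \<beta> ^ (2 * k) dvd
        (\<Sum>\<gamma>\<in>P - {\<beta>}. (real k * blinfun_apply \<gamma> v) *\<^sub>R root_quotient \<gamma> g \<beta>)"
      by (intro dvd_sum polyfun_dvd_scaleR other)
    ultimately show ?thesis by simp
  qed
  ultimately show ?thesis by (simp add: multi_fields_def)
qed

text \<open>
  The annihilator of the direction of \<open>g\<close> in \<open>V\<^sup>*\<close> is the proper nonzero reflection-stable subspace.
\<close>
lemma multi_fields_one_below:
  fixes \<Xi> :: "'a::euclidean_space \<Rightarrow> ('a \<Rightarrow>\<^sub>L real) \<Rightarrow> 'a polyfun"
  assumes root: "root_system \<Phi>" and irr: "irreducible_roots \<Phi>" and half: "positive_half \<Phi> P"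
    and k: "k \<ge> 1" and dim: "2 \<le> DIM('a)"
    and linX: "\<And>a. linear (\<lambda>v. \<Xi> v a)" and sub: "multi_fields P (2 * k) (Suc n) \<subseteq> range \<Xi>"
    and g: "g \<in> multi_fields P (2 * k) n"
  shows "g a = 0"
proof (rule ccontr)
  assume nz: "g a \<noteq> 0"
  have P\<Phi>: "P \<subseteq> \<Phi>" using half by (auto simp: positive_half_def)
  have nz\<Phi>: "\<gamma> \<noteq> 0" if "\<gamma> \<in> \<Phi>" for \<gamma> using that root_system_nonzero[OF root] by blast
  have lin: "linear g" and hom: "\<And>a. homogeneous_poly n (g a)" using g by (auto simp: multi_fields_def)
  have dvd: "lform \<beta> ^ (2 * k) dvd g \<beta>" if "\<beta> \<in> \<Phi>" for \<beta>
    using multi_fields_root_dvd[OF half g that] .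
  have dvd1: "lform \<beta> dvd g \<beta>" if "\<beta> \<in> \<Phi>" for \<beta>
    using dvd_trans[OF dvd_power dvd[OF that]] k by simp
  obtain \<beta>0 where \<beta>0: "\<beta>0 \<in> \<Phi>" "g \<beta>0 \<noteq> 0" using linear_root_system_eq_0[OF root lin] nz by blast
  \<comment> \<open>This leaves room for the Dunkl operator to lower the degree.\<close>
  have "n \<noteq> 0"
  proof
    assume "n = 0"
    then have "g \<beta>0 = 0"
      using homogeneous_poly_lform_power_dvd[OF hom dvd nz\<Phi>] \<beta>0 k by simp
    then show False using \<beta>0 by simp
  qed
  then obtain n' where n': "n = Suc n'" using not0_implies_Suc by blast
  \<comment> \<open>The Dunkl image lies two degrees below the one parametrized by
    \<open>\<Xi>\<close>.\<close>
  have T: "dunkl P k v g b = 0" for v b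
    by (rule multi_fields_two_below[OF linX _ dim dunkl_multi_fields[OF root half k]])
       (use sub g in \<open>simp_all add: n'\<close>)
  have "\<exists>c. \<forall>b. reflect_field \<gamma> g b = c *\<^sub>R g b" if "\<gamma> \<in> \<Phi>" for \<gamma>
    using multi_fields_proportional[OF linX sub dim g nz reflect_field_multi_fields[OF root half g that]]
    by metis
  then obtain c where c: "\<And>\<gamma> b. \<gamma> \<in> \<Phi> \<Longrightarrow> reflect_field \<gamma> g b = c \<gamma> *\<^sub>R g b" by metis
  \<comment> \<open>The kernel of \<open>g\<close> contains \<open>b\<close> and its reflection,
    hence their difference, a multiple of \<open>\<gamma>\<close>; as \<open>g \<gamma>\<close> is
    nonzero, the coefficient vanishes.\<close>
  have stable: "dual_inner b \<gamma> = 0" if "g b = 0" "\<gamma> \<in> \<Phi>" "g \<gamma> \<noteq> 0" for b \<gamma>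
  proof -
    have "g (dual_reflection \<gamma> b) = 0"
      using c[OF that(2), of b] that pullback_reflection_eq_0_iff[OF nz\<Phi>] by (simp add: reflect_field_def)
    then have "(2 * dual_inner b \<gamma> / dual_inner \<gamma> \<gamma>) *\<^sub>R g \<gamma> = 0"
      using that(1) by (simp add: dual_reflection_def linear_diff[OF lin] linear_cmul[OF lin])
    then show ?thesis using that nz\<Phi> by simp
  qed
  \<comment> \<open>Otherwise the roots inside and outside the kernel of \<open>g\<close> would
    split \<Phi> orthogonally.\<close>
  have all: "g \<gamma> \<noteq> 0" if "\<gamma> \<in> \<Phi>" for \<gamma>
  proof
    assume "g \<gamma> = 0"
    let ?A = "{\<gamma> \<in> \<Phi>. g \<gamma> \<noteq> 0}" and ?B = "{\<gamma> \<in> \<Phi>. g \<gamma> = 0}"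
    have "?A \<noteq> {} \<and> ?B \<noteq> {} \<and> ?A \<inter> ?B = {} \<and> ?A \<union> ?B = \<Phi>"
      using \<beta>0 that \<open>g \<gamma> = 0\<close> by auto
    moreover have "\<forall>\<alpha>\<in>?A. \<forall>\<beta>\<in>?B. dual_inner \<alpha> \<beta> = 0"
      using stable dual_inner_commute by (metis (mono_tags, lifting) mem_Collect_eq)
    ultimately have "\<exists>A B. A \<noteq> {} \<and> B \<noteq> {} \<and> A \<inter> B = {} \<and> A \<union> B = \<Phi> \<and>
        (\<forall>\<alpha>\<in>A. \<forall>\<beta>\<in>B. dual_inner \<alpha> \<beta> = 0)"
      by (intro exI[of _ ?A] exI[of _ ?B]) simp
    then show False using irr by (simp add: irreducible_roots_def)
  qed
  \<comment> \<open>Each divided difference is \<open>(1 - c \<gamma>) / \<gamma>\<close> times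
    \<open>g\<close>, so the vanishing Dunkl images give all nonzero values of \<open>g\<close> the
    same logarithmic derivative.\<close>
  have ode: "g b2 * dpoly v (g b1) = g b1 * dpoly v (g b2)" for b1 b2 v
  proof -
    have q: "g b2 * root_quotient \<gamma> g b1 = g b1 * root_quotient \<gamma> g b2" if "\<gamma> \<in> P" for \<gamma>
    proof -
      have \<gamma>: "\<gamma> \<in> \<Phi>" using that P\<Phi> by blast
      have q: "lform \<gamma> * root_quotient \<gamma> g b = (1 - c \<gamma>) *\<^sub>R g b" for b
        using root_quotient[OF nz\<Phi>[OF \<gamma>] lin dvd1[OF \<gamma>], of b] c[OF \<gamma>] by (simp add: scaleR_diff_left)
      have "lform \<gamma> * (g b2 * root_quotient \<gamma> g b1) = g b2 * (lform \<gamma> * root_quotient \<gamma> g b1)"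
        by (simp add: ac_simps)
      also have "\<dots> = g b1 * (lform \<gamma> * root_quotient \<gamma> g b2)"
        unfolding q by (simp add: polyfun_scaleR_mult mult.commute)
      also have "\<dots> = lform \<gamma> * (g b1 * root_quotient \<gamma> g b2)"
        by (simp add: ac_simps)
      finally show ?thesis using nz\<Phi>[OF \<gamma>] by simp
    qed
    have "dpoly v (g b) = (\<Sum>\<gamma>\<in>P. (real k * blinfun_apply \<gamma> v) *\<^sub>R root_quotient \<gamma> g b)" for b
      using T[of v b] by (simp add: dunkl_def)
    then show ?thesis
      by (simp add: sum_distrib_left polyfun_scaleR_mult q cong: sum.cong)
  qed
  obtain y where y: "poly_fun (g a) y \<noteq> 0" using nz by (metis polyfun_eqI poly_fun_simps(1))
  \<comment> \<open>The values of \<open>g\<close> are constant multiples of one polynomial: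
    \<open>g\<close> has a constant direction \<open>t\<close>.\<close>
  define t where "t b = poly_fun (g b) y / poly_fun (g a) y" for b
  have t: "g b = t b *\<^sub>R g a" for b
    unfolding t_def by (rule polyfun_proportional[OF ode y])
  obtain b1 b2 :: 'a where b: "b1 \<in> Basis" "b2 \<in> Basis" "b1 \<noteq> b2" "b1 \<bullet> b2 = 0"
    using DIM_ge_2_obtain[OF dim] by blast
  define l1 where "l1 = (blinfun_inner_left b1 :: 'a \<Rightarrow>\<^sub>L real)"
  define l2 where "l2 = (blinfun_inner_left b2 :: 'a \<Rightarrow>\<^sub>L real)"
  have app: "blinfun_apply l1 b1 = 1" "blinfun_apply l1 b2 = 0" "blinfun_apply l2 b2 = 1"
    using b by (simp_all add: l1_def l2_def inner_commute)
  \<comment> \<open>The values of \<open>g\<close> span a line, so some combination of two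
    independent forms is killed.\<close>
  obtain u where u: "u \<noteq> 0" "g u = 0"
  proof (cases "t l1 = 0")
    case True
    moreover have "l1 \<noteq> 0" using app by auto
    ultimately show ?thesis using that[of l1] t[of l1] by simp
  next
    case False
    let ?u = "l2 - (t l2 / t l1) *\<^sub>R l1"
    have "blinfun_apply ?u b2 = 1" by (simp add: blinfun.bilinear_simps app)
    then have "?u \<noteq> 0" by auto
    moreover have "g ?u = (t l2 - t l2 / t l1 * t l1) *\<^sub>R g a"
      unfolding linear_diff[OF lin] linear_cmul[OF lin] t[of l1] t[of l2]
      by (simp add: scaleR_diff_left)
    ultimately show ?thesis using that[of ?u] False by simp
  qed
  \<comment> \<open>By \<open>stable\<close> and \<open>all\<close>, \<open>u\<close> is orthogonal
    to every root; the roots span, so \<open>u\<close> is orthogonal to itself.\<close>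
  have "linear (\<lambda>b. dual_inner u b)"
    unfolding dual_inner_conv
    by (intro linearI) (simp_all add: linear_add[OF riesz_linear] linear_cmul[OF riesz_linear] blinfun.bilinear_simps)
  then have "dual_inner u u = 0"
    by (rule linear_root_system_eq_0[OF root]) (use stable u all in blast)
  then show False using u by simp
qed

section \<open>Simple roots, the dual basis and the degree bound\<close>

lemma linear_functional_eq_apply:
  fixes f :: "('a::euclidean_space \<Rightarrow>\<^sub>L real) \<Rightarrow> real"
  assumes "linear f"
  obtains v where "\<And>a. f a = blinfun_apply a v"
proof
  fix a
  have "f a = (\<Sum>b\<in>Basis. blinfun_apply a b * f (blinfun_inner_left b))"
    by (subst blinfun_inner_expansion) (simp add: linear_sum[OF assms] linear_cmul[OF assms])
  then show "f a = blinfun_apply a (\<Sum>b\<in>Basis. f (blinfun_inner_left b) *\<^sub>R b)"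
    by (simp add: blinfun.sum_right blinfun.scaleR_right mult.commute)
qed

lemma simple_rootsD:
  fixes \<alpha> :: "nat \<Rightarrow> 'a::euclidean_space \<Rightarrow>\<^sub>L real"
  assumes "simple_roots \<Phi> P \<alpha>"
  shows "\<alpha> ` {1..DIM('a)} \<subseteq> \<Phi>" "inj_on \<alpha> {1..DIM('a)}" "independent (\<alpha> ` {1..DIM('a)})"
    and "span (\<alpha> ` {1..DIM('a)}) = UNIV"
    and "P = {\<beta> \<in> \<Phi>. \<exists>n :: nat \<Rightarrow> nat. \<beta> = (\<Sum>i = 1..DIM('a). real (n i) *\<^sub>R \<alpha> i)}"
    and "\<Phi> = P \<union> uminus ` P"
  using assms unfolding simple_roots_def by - (elim conjE, assumption)+

text \<open>Independence of the simple roots yields a functional with the prescribed values,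
  represented by a vector; spanning makes that vector unique, as the definite description
  requires.\<close>

lemma dual_basis_apply:
  fixes \<alpha> :: "nat \<Rightarrow> 'a::euclidean_space \<Rightarrow>\<^sub>L real"
  assumes "simple_roots \<Phi> P \<alpha>" "j \<in> {1..DIM('a)}" "i \<in> {1..DIM('a)}"
  shows "blinfun_apply (\<alpha> i) (dual_basis \<alpha> j) = (if i = j then 1 else 0)"
proof -
  let ?I = "{1..DIM('a)}"
  have inj: "inj_on \<alpha> ?I" and ind: "independent (\<alpha> ` ?I)" and sp: "span (\<alpha> ` ?I) = UNIV"
    using simple_rootsD[OF assms(1)] by blast+
  obtain f :: "_ \<Rightarrow> real" where f: "linear f" "\<forall>x\<in>\<alpha> ` ?I. f x = (if x = \<alpha> j then 1 else 0)"
    using linear_independent_extend[OF ind, of "\<lambda>x. if x = \<alpha> j then 1 else 0"] by auto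
  obtain v where v: "\<And>a. f a = blinfun_apply a v" using linear_functional_eq_apply[OF f(1)] by blast
  have spec: "\<forall>i\<in>?I. blinfun_apply (\<alpha> i) v = (if i = j then 1 else 0)"
    using f(2) inj assms(2) by (auto simp flip: v dest: inj_onD)
  have uniq: "w = v" if w: "\<forall>i\<in>?I. blinfun_apply (\<alpha> i) w = (if i = j then 1 else 0)" for w
  proof -
    have "linear (\<lambda>a::'a \<Rightarrow>\<^sub>L real. blinfun_apply a (w - v))"
      by (rule linearI) (simp_all add: blinfun.add_left blinfun.scaleR_left)
    moreover have "blinfun_apply a (w - v) = 0" if "a \<in> \<alpha> ` ?I" for a
      using that w spec by (auto simp: blinfun.diff_right)
    ultimately have "blinfun_apply a (w - v) = 0" for a :: "'a \<Rightarrow>\<^sub>L real"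
      using linear_eq_0_on_span[of "\<lambda>a. blinfun_apply a (w - v)" "\<alpha> ` ?I" a] sp by blast
    from this[of "blinfun_inner_left (w - v)"] show ?thesis by simp
  qed
  have "\<forall>i\<in>?I. blinfun_apply (\<alpha> i) (dual_basis \<alpha> j) = (if i = j then 1 else 0)"
    unfolding dual_basis_def by (rule theI[of _ v]) (use spec uniq in blast)+
  then show ?thesis using assms(3) by blast
qed

lemma positive_root_expansion:
  fixes \<alpha> :: "nat \<Rightarrow> 'a::euclidean_space \<Rightarrow>\<^sub>L real"
  assumes "simple_roots \<Phi> P \<alpha>" "\<beta> \<in> P"
  shows "\<beta> = (\<Sum>i = 1..DIM('a). blinfun_apply \<beta> (dual_basis \<alpha> i) *\<^sub>R \<alpha> i)"
    and "\<And>j. j \<in> {1..DIM('a)} \<Longrightarrow> 0 \<le> blinfun_apply \<beta> (dual_basis \<alpha> j)"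
proof -
  obtain n :: "nat \<Rightarrow> nat" where n: "\<beta> = (\<Sum>i = 1..DIM('a). real (n i) *\<^sub>R \<alpha> i)"
    using simple_rootsD(5)[OF assms(1)] assms(2) by blast
  have coeff: "blinfun_apply \<beta> (dual_basis \<alpha> j) = real (n j)" if j: "j \<in> {1..DIM('a)}" for j
  proof -
    have "blinfun_apply \<beta> (dual_basis \<alpha> j) = (\<Sum>i = 1..DIM('a). if i = j then real (n i) else 0)"
      unfolding n blinfun.sum_left
      by (rule sum.cong) (simp_all add: blinfun.bilinear_simps dual_basis_apply[OF assms(1) j])
    then show ?thesis using j by simp
  qed
  show "\<beta> = (\<Sum>i = 1..DIM('a). blinfun_apply \<beta> (dual_basis \<alpha> i) *\<^sub>R \<alpha> i)"
    by (subst n) (simp add: coeff)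
  show "0 \<le> blinfun_apply \<beta> (dual_basis \<alpha> j)" if "j \<in> {1..DIM('a)}" for j
    using coeff[OF that] by simp
qed

lemma simple_root_positive:
  fixes \<alpha> :: "nat \<Rightarrow> 'a::euclidean_space \<Rightarrow>\<^sub>L real"
  assumes "simple_roots \<Phi> P \<alpha>" "i \<in> {1..DIM('a)}"
  shows "\<alpha> i \<in> P"
proof -
  have "\<alpha> i = (\<Sum>j = 1..DIM('a). real (if j = i then 1 else 0) *\<^sub>R \<alpha> j)"
    using assms(2) by (simp add: if_distrib[of "\<lambda>c. c *\<^sub>R _"] if_distrib[of real] sum.delta cong: if_cong)
  then have "\<exists>n :: nat \<Rightarrow> nat. \<alpha> i = (\<Sum>j = 1..DIM('a). real (n j) *\<^sub>R \<alpha> j)"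
    by (intro exI[of _ "\<lambda>j. if j = i then 1 else 0"])
  then show ?thesis using simple_rootsD(1,5)[OF assms(1)] assms(2) by blast
qed

lemma simple_roots_positive_half:
  fixes \<alpha> :: "nat \<Rightarrow> 'a::euclidean_space \<Rightarrow>\<^sub>L real"
  assumes "root_system \<Phi>" "simple_roots \<Phi> P \<alpha>"
  shows "positive_half \<Phi> P"
  unfolding positive_half_def
proof (intro conjI ballI notI)
  show eq: "\<Phi> = P \<union> uminus ` P" using simple_rootsD(6)[OF assms(2)] .
  fix \<beta> assume \<beta>: "\<beta> \<in> P" "- \<beta> \<in> P"
  have "blinfun_apply \<beta> (dual_basis \<alpha> j) = 0" if "j \<in> {1..DIM('a)}" for j
    using positive_root_expansion(2)[OF assms(2) \<beta>(1) that]
      positive_root_expansion(2)[OF assms(2) \<beta>(2) that] by (simp add: blinfun.bilinear_simps)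
  then have "\<beta> = 0" by (subst positive_root_expansion(1)[OF assms(2) \<beta>(1)]) simp
  then show False using \<beta> eq root_system_nonzero[OF assms(1)] by blast
qed

text \<open>By reducedness \<open>\<beta>\<close> has a positive coefficient at some
  \<open>j\<close> other than \<open>i\<close>. The reflection changes only the coefficient at
  \<open>i\<close>, so the image cannot be negative.\<close>

lemma simple_reflection_positive:
  fixes \<alpha> :: "nat \<Rightarrow> 'a::euclidean_space \<Rightarrow>\<^sub>L real"
  assumes root: "root_system \<Phi>" and simple: "simple_roots \<Phi> P \<alpha>" and i: "i \<in> {1..DIM('a)}"
    and \<beta>: "\<beta> \<in> P" "\<beta> \<noteq> \<alpha> i"
  shows "dual_reflection (\<alpha> i) \<beta> \<in> P"
proof -
  have half: "\<Phi> = P \<union> uminus ` P" "\<And>\<gamma>. \<gamma> \<in> P \<Longrightarrow> - \<gamma> \<notin> P"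
    using simple_roots_positive_half[OF root simple] by (auto simp: positive_half_def)
  have "\<exists>j\<in>{1..DIM('a)}. j \<noteq> i \<and> blinfun_apply \<beta> (dual_basis \<alpha> j) \<noteq> 0"
  proof (rule ccontr)
    assume "\<not> ?thesis"
    then have "\<beta> = (\<Sum>j = 1..DIM('a). if j = i then blinfun_apply \<beta> (dual_basis \<alpha> i) *\<^sub>R \<alpha> i else 0)"
      by (subst positive_root_expansion(1)[OF simple \<beta>(1)]) (intro sum.cong, auto)
    then have "\<beta> = blinfun_apply \<beta> (dual_basis \<alpha> i) *\<^sub>R \<alpha> i" using i by simp
    then obtain c where c: "\<beta> = c *\<^sub>R \<alpha> i" by blast
    have "\<alpha> i \<in> \<Phi>" "\<beta> \<in> \<Phi>" using half \<beta> simple_root_positive[OF simple i] by auto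
    then have "c = 1 \<or> c = - 1" using root c unfolding root_system_def by blast
    then show False using c \<beta> half(2) simple_root_positive[OF simple i] by auto
  qed
  then obtain j where j: "j \<in> {1..DIM('a)}" "j \<noteq> i" "blinfun_apply \<beta> (dual_basis \<alpha> j) \<noteq> 0" by blast
  have pos: "0 < blinfun_apply \<beta> (dual_basis \<alpha> j)"
    using positive_root_expansion(2)[OF simple \<beta>(1) j(1)] j(3) by simp
  have "blinfun_apply (dual_reflection (\<alpha> i) \<beta>) (dual_basis \<alpha> j) = blinfun_apply \<beta> (dual_basis \<alpha> j)"
    using dual_basis_apply[OF simple j(1) i] j(2) by (simp add: dual_reflection_def blinfun.bilinear_simps)
  moreover have "dual_reflection (\<alpha> i) \<beta> \<in> \<Phi>"
    using root_system_reflection[OF root] half \<beta> simple_root_positive[OF simple i] by blast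
  ultimately show ?thesis
    using half(1) pos positive_root_expansion(2)[OF simple, of "- dual_reflection (\<alpha> i) \<beta>" j] j(1)
    by (force simp: blinfun.bilinear_simps)
qed

text \<open>The Coxeter element is a single reflection, whose square is the identity.\<close>

lemma coxeter_number_rank_one:
  fixes \<alpha> :: "nat \<Rightarrow> 'a::euclidean_space \<Rightarrow>\<^sub>L real"
  assumes "DIM('a) = 1" "\<alpha> 1 \<noteq> 0"
  shows "coxeter_number \<alpha> \<le> 2"
proof -
  have "coxeter_element \<alpha> = reflection (\<alpha> 1) o\<^sub>L id_blinfun"
    using assms(1) by (simp add: coxeter_element_def)
  then have "(blinfun_apply (coxeter_element \<alpha>) ^^ 2) = id"
    using reflection_involution[OF assms(2)] by (simp add: fun_eq_iff numeral_2_eq_2)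
  then show ?thesis unfolding coxeter_number_def by (intro Least_le) simp
qed

text \<open>
  Terao's theorem that all exponents of the Coxeter multiarrangement with constant multiplicity
  \<open>2k\<close> equal \<open>kh\<close>, in the only form needed: there is nothing below degree \<open>kh\<close>.  Here it
  follows from the fact that degree \<open>kh\<close> has dimension \<open>\<ell>\<close>.
\<close>
lemma multi_fields_eq_0:
  fixes \<alpha> :: "nat \<Rightarrow> 'a::euclidean_space \<Rightarrow>\<^sub>L real"
  assumes root: "root_system \<Phi>" and irr: "irreducible_roots \<Phi>" and simple: "simple_roots \<Phi> P \<alpha>"
    and k: "k \<ge> 1"
    and iso: "weyl_isomorphism \<Phi> (degree_part (multi_derivations P (2 * k)) (k * coxeter_number \<alpha>)) \<Xi>"
    and n: "n < k * coxeter_number \<alpha>" and g: "g \<in> multi_fields P (2 * k) n"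
  shows "g a = 0"
proof -
  have half: "positive_half \<Phi> P" using simple_roots_positive_half[OF root simple] .
  have one: "1 \<in> {1..DIM('a)}" by simp
  have \<alpha>1: "\<alpha> 1 \<in> P" "\<alpha> 1 \<noteq> 0"
    using simple_root_positive[OF simple one] half root_system_nonzero[OF root]
    by (auto simp: positive_half_def)
  show ?thesis
  proof (cases "DIM('a) = 1")
    case True
    \<comment> \<open>In rank one the degree is too small for the factor
      \<open>\<alpha> 1 ^ (2 * k)\<close>.\<close>
    have "n < k * 2"
      using n coxeter_number_rank_one[of \<alpha>, OF True \<alpha>1(2)] mult_le_mono2 order_less_le_trans by blast
    then have "g (\<alpha> 1) = 0"
      using homogeneous_poly_lform_power_dvd[of n "g (\<alpha> 1)" "\<alpha> 1" "2 * k"] g \<alpha>1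
      by (auto simp: multi_fields_def)
    moreover have "a \<in> span {\<alpha> 1}" using simple_rootsD(4)[OF simple] True by simp
    ultimately show ?thesis
      using g linear_eq_0_on_span[of g "{\<alpha> 1}" a] by (auto simp: multi_fields_def)
  next
    case False
    then have dim: "2 \<le> DIM('a)" using DIM_positive[where 'a='a] by linarith
    let ?\<Xi> = "\<lambda>v a. \<Xi> v (lform a)"
    have lin: "linear (\<lambda>v. ?\<Xi> v a)" for a using iso by (simp add: weyl_isomorphism_def)
    have sub: "multi_fields P (2 * k) (k * coxeter_number \<alpha>) \<subseteq> range ?\<Xi>"
    proof
      fix h assume "h \<in> multi_fields P (2 * k) (k * coxeter_number \<alpha>)"
      then obtain \<theta> where \<theta>: "\<theta> \<in> degree_part (multi_derivations P (2 * k)) (k * coxeter_number \<alpha>)"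
        "\<And>a. \<theta> (lform a) = h a" using multi_fields_derivation_exists by blast
      then obtain v where "\<theta> = \<Xi> v"
        using iso unfolding weyl_isomorphism_def bij_betw_def by blast
      then have "h = ?\<Xi> v" using \<theta>(2) by auto
      then show "h \<in> range ?\<Xi>" by blast
    qed
    \<comment> \<open>Descend from degree \<open>kh - 1\<close>: multiplication by
      \<open>\<alpha> 1\<close> is injective and raises the degree by one.\<close>
    have "n \<le> k * coxeter_number \<alpha> - 1" using n by simp
    then show ?thesis using g
    proof (induction n arbitrary: g rule: inc_induct)
      case base
      have "Suc (k * coxeter_number \<alpha> - 1) = k * coxeter_number \<alpha>" using n by simp
      then show ?case using multi_fields_one_below[OF root irr half k dim lin _ base] sub by simp
    next
      case (step m)
      have "lform (\<alpha> 1) * g a = 0"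
        using step.IH[OF multi_fields_lform_mult[OF step.prems, of "\<alpha> 1"]] .
      then show ?case using \<alpha>1 by simp
    qed
  qed
qed

section \<open>Derivations on the cone\<close>

lemma cone_form_apply [simp]: "blinfun_apply (cone_form \<beta> j) p = blinfun_apply \<beta> (fst p) - real_of_int j * snd p"
  by (simp add: cone_form_def blinfun.bilinear_simps)

lemma cone_form_nonzero: "\<beta> \<noteq> 0 \<Longrightarrow> cone_form \<beta> j \<noteq> 0"
proof -
  assume "\<beta> \<noteq> 0"
  then obtain w where "blinfun_apply \<beta> w = 1" using blinfun_real_obtain_one by blast
  then have "blinfun_apply (cone_form \<beta> j) (w, 0) = 1" by simp
  then show ?thesis by (metis zero_blinfun.rep_eq zero_neq_one)
qed

lemma lform_cone_form: "lform (cone_form \<beta> j) = lform (\<beta> o\<^sub>L fst_blinfun) - real_of_int j *\<^sub>R lform snd_blinfun"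
  by (simp add: cone_form_def lform_linear)

lemma snd_blinfun_nonzero: "snd_blinfun \<noteq> (0 :: ('a::euclidean_space \<times> real) \<Rightarrow>\<^sub>L real)"
proof
  assume "snd_blinfun = (0 :: ('a \<times> real) \<Rightarrow>\<^sub>L real)"
  then have "blinfun_apply (snd_blinfun :: ('a \<times> real) \<Rightarrow>\<^sub>L real) (0, 1) = 0" by simp
  then show False by simp
qed

text \<open>Test at zeros of \<open>cone_form \<beta> j\<close>: at \<open>(j w, 1)\<close> with
  \<open>\<beta> w = 1\<close> for the first two claims, at \<open>(x, 0)\<close> with
  \<open>\<beta> x = 0\<close> for the third.\<close>

lemma cone_form_not_dvd:
  assumes "\<beta> \<noteq> 0"
  shows "\<not> lform (cone_form \<beta> j) dvd lform snd_blinfun"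
    and "i \<noteq> j \<Longrightarrow> \<not> lform (cone_form \<beta> j) dvd lform (cone_form \<beta> i)"
    and "\<not> lform \<beta> dvd lform \<gamma> \<Longrightarrow> \<not> lform (cone_form \<beta> j) dvd lform (cone_form \<gamma> i)"
proof -
  obtain w where "blinfun_apply \<beta> w = 1" using assms blinfun_real_obtain_one by blast
  then have w: "blinfun_apply (cone_form \<beta> j) (real_of_int j *\<^sub>R w, 1) = 0"
    and wi: "blinfun_apply (cone_form \<beta> i) (real_of_int j *\<^sub>R w, 1) = real_of_int (j - i)"
    by (simp_all add: blinfun.bilinear_simps)
  note iff = lform_dvd_iff[OF cone_form_nonzero[OF assms], of j]
  show "\<not> lform (cone_form \<beta> j) dvd lform snd_blinfun"
  proof
    assume "lform (cone_form \<beta> j) dvd lform snd_blinfun"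
    then have "poly_fun (lform snd_blinfun) (real_of_int j *\<^sub>R w, 1) = 0" using w iff by blast
    then show False by simp
  qed
  show "\<not> lform (cone_form \<beta> j) dvd lform (cone_form \<beta> i)" if "i \<noteq> j"
  proof
    assume "lform (cone_form \<beta> j) dvd lform (cone_form \<beta> i)"
    then have "poly_fun (lform (cone_form \<beta> i)) (real_of_int j *\<^sub>R w, 1) = 0" using w iff by blast
    then show False using wi that by (simp del: cone_form_apply)
  qed
  show "\<not> lform (cone_form \<beta> j) dvd lform (cone_form \<gamma> i)" if nd: "\<not> lform \<beta> dvd lform \<gamma>"
  proof -
    obtain x where "blinfun_apply \<beta> x = 0" "blinfun_apply \<gamma> x \<noteq> 0"
      using nd lform_dvd_iff[OF assms] by auto
    then have "blinfun_apply (cone_form \<beta> j) (x, 0) = 0" "poly_fun (lform (cone_form \<gamma> i)) (x, 0) \<noteq> 0"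
      by simp_all
    then show ?thesis using iff by blast
  qed
qed

lemma pullback_zero_section_cone_form: "pullback zero_section (lform (cone_form \<beta> j)) = lform \<beta>"
  by (rule polyfun_eqI) simp

lemma pullback_zero_section_cone_ext:
  "pullback zero_section (pullback (cone_ext w) f) = pullback w (pullback zero_section f)"
  by (rule polyfun_eqI) simp

lemma pullback_cone_reflection_form:
  "pullback (cone_ext (reflection \<gamma>)) (lform (\<beta> o\<^sub>L fst_blinfun)) = lform (dual_reflection \<gamma> \<beta> o\<^sub>L fst_blinfun)"
  "pullback (cone_ext (reflection \<gamma>)) (lform snd_blinfun) = lform snd_blinfun"
  "pullback (cone_ext (reflection \<gamma>)) (lform (cone_form \<beta> j)) = lform (cone_form (dual_reflection \<gamma> \<beta>) j)"
  by (rule polyfun_eqI; simp add: dual_reflection_apply)+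

lemma pullback_cone_reflection_involution:
  "\<gamma> \<noteq> 0 \<Longrightarrow> pullback (cone_ext (reflection \<gamma>)) (pullback (cone_ext (reflection \<gamma>)) f) = f"
  by (rule polyfun_eqI) (simp add: reflection_involution)

lemma snd_dvd_iff:
  fixes f :: "('a::euclidean_space \<times> real) polyfun"
  shows "lform snd_blinfun dvd f \<longleftrightarrow> pullback zero_section f = 0"
proof
  assume "pullback zero_section f = 0"
  then have "poly_fun f (x, 0) = 0" for x
    by (metis poly_fun_simps(1,9) zero_section_apply)
  then show "lform snd_blinfun dvd f"
    unfolding lform_dvd_iff[OF snd_blinfun_nonzero] by simp
next
  assume "lform snd_blinfun dvd f"
  then have "poly_fun f (x, 0) = 0" for x
    unfolding lform_dvd_iff[OF snd_blinfun_nonzero] by simp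
  then show "pullback zero_section f = 0"
    by (intro polyfun_eqI) simp
qed

text \<open>
  The divisibility conditions of \<open>S\<^sup>k\<close> with the hyperplane \<open>\<gamma> = kz\<close> omitted; for a simple root
  \<open>\<gamma>\<close> the remaining arrangement is stable under the reflection in \<open>\<gamma>\<close>.
\<close>
definition partial_shi_field ::
    "('a::euclidean_space \<Rightarrow>\<^sub>L real) set \<Rightarrow> nat \<Rightarrow> ('a \<Rightarrow>\<^sub>L real) \<Rightarrow> nat \<Rightarrow>
     (('a \<Rightarrow>\<^sub>L real) \<Rightarrow> ('a \<times> real) polyfun) \<Rightarrow> bool" where
  "partial_shi_field P k \<gamma> n K \<longleftrightarrow> linear K \<and> (\<forall>a. homogeneous_poly n (K a)) \<and>
     (\<forall>\<beta>\<in>P. \<forall>j. - int k < j \<longrightarrow> j \<le> int k \<longrightarrow> (\<beta> = \<gamma> \<longrightarrow> j < int k) \<longrightarrow>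
        lform (cone_form \<beta> j) dvd K \<beta>)"

text \<open>The action on a derivation annihilating \<open>z\<close>, recorded at forms pulled back
  from \<open>V\<close>; \<open>Der_cone_eqI\<close> shows that these values determine it.\<close>

definition cone_reflect_field ::
    "('a::euclidean_space \<Rightarrow>\<^sub>L real) \<Rightarrow> (('a \<Rightarrow>\<^sub>L real) \<Rightarrow> ('a \<times> real) polyfun) \<Rightarrow>
     ('a \<Rightarrow>\<^sub>L real) \<Rightarrow> ('a \<times> real) polyfun" where
  "cone_reflect_field \<gamma> K a = pullback (cone_ext (reflection \<gamma>)) (K (dual_reflection \<gamma> a))"

lemma cone_reflect_field_linear: "linear K \<Longrightarrow> linear (cone_reflect_field \<gamma> K)"
  by (rule linearI)
     (simp_all add: cone_reflect_field_def linear_add[OF dual_reflection_linear]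
       linear_cmul[OF dual_reflection_linear] linear_add linear_cmul pullback_simps)

text \<open>At \<open>\<alpha> i\<close> the reflection sends level \<open>j\<close> to
  \<open>- j\<close>, and without \<open>j = k\<close> the levels are symmetric. The other positive
  roots are permuted with their levels kept.\<close>

lemma partial_shi_field_reflect:
  fixes \<alpha> :: "nat \<Rightarrow> 'a::euclidean_space \<Rightarrow>\<^sub>L real"
  assumes root: "root_system \<Phi>" and simple: "simple_roots \<Phi> P \<alpha>" and i: "i \<in> {1..DIM('a)}"
    and K: "partial_shi_field P k (\<alpha> i) n K"
  shows "partial_shi_field P k (\<alpha> i) n (cone_reflect_field (\<alpha> i) K)"
  unfolding partial_shi_field_def
proof (intro conjI allI ballI impI)
  have lin: "linear K" and hom: "\<And>a. homogeneous_poly n (K a)"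
    and dvd: "\<And>\<beta> j. \<lbrakk>\<beta> \<in> P; - int k < j; j \<le> int k; \<beta> = \<alpha> i \<longrightarrow> j < int k\<rbrakk> \<Longrightarrow>
      lform (cone_form \<beta> j) dvd K \<beta>"
    using K by (auto simp: partial_shi_field_def)
  have half: "positive_half \<Phi> P" using simple_roots_positive_half[OF root simple] .
  have \<alpha>i: "\<alpha> i \<in> P" "\<alpha> i \<noteq> 0"
    using simple_root_positive[OF simple i] half root_system_nonzero[OF root]
    by (auto simp: positive_half_def)
  let ?s = "dual_reflection (\<alpha> i)" and ?S = "pullback (cone_ext (reflection (\<alpha> i)))"
  show "linear (cone_reflect_field (\<alpha> i) K)" using lin by (rule cone_reflect_field_linear)
  show "homogeneous_poly n (cone_reflect_field (\<alpha> i) K a)" for a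
    by (simp add: cone_reflect_field_def homogeneous_poly_pullback hom)
  fix \<beta> j assume \<beta>: "\<beta> \<in> P" and j: "- int k < j" "j \<le> int k" "\<beta> = \<alpha> i \<longrightarrow> j < int k"
  show "lform (cone_form \<beta> j) dvd cone_reflect_field (\<alpha> i) K \<beta>"
  proof (cases "\<beta> = \<alpha> i")
    case True
    have "lform (cone_form (\<alpha> i) (- j)) dvd K (\<alpha> i)" using dvd[OF \<alpha>i(1)] j True by auto
    then have "?S (lform (cone_form (\<alpha> i) (- j))) dvd ?S (K (\<alpha> i))" by (rule pullback_dvd)
    moreover have "?S (lform (cone_form (\<alpha> i) (- j))) = - lform (cone_form (\<alpha> i) j)"
      unfolding pullback_cone_reflection_form dual_reflection_self[OF \<alpha>i(2)]
      by (rule polyfun_eqI) (simp add: blinfun.bilinear_simps)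
    moreover have "cone_reflect_field (\<alpha> i) K \<beta> = - ?S (K (\<alpha> i))"
      by (simp add: cone_reflect_field_def True dual_reflection_self[OF \<alpha>i(2)] linear_neg[OF lin] pullback_simps)
    ultimately show ?thesis using True by simp
  next
    case False
    have s\<beta>: "?s \<beta> \<in> P" using simple_reflection_positive[OF root simple i \<beta> False] .
    have "?s \<beta> \<noteq> \<alpha> i"
    proof
      assume "?s \<beta> = \<alpha> i"
      then have "\<beta> = - \<alpha> i"
        using dual_reflection_involution[OF \<alpha>i(2), of \<beta>] dual_reflection_self[OF \<alpha>i(2)] by simp
      then show False using \<beta> half \<alpha>i by (auto simp: positive_half_def)
    qed
    then have "?S (lform (cone_form (?s \<beta>) j)) dvd ?S (K (?s \<beta>))"
      using dvd[OF s\<beta> j(1,2)] by (intro pullback_dvd) simp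
    then show ?thesis
      unfolding pullback_cone_reflection_form dual_reflection_involution[OF \<alpha>i(2)]
      by (simp add: cone_reflect_field_def)
  qed
qed

lemma partial_shi_field_diff:
  assumes "partial_shi_field P k \<gamma> n K" "partial_shi_field P k \<gamma> n L"
  shows "partial_shi_field P k \<gamma> n (\<lambda>a. K a - L a)"
  using assms unfolding partial_shi_field_def
  by (intro conjI allI ballI impI linear_compose_sub homogeneous_poly_diff dvd_diff) blast+

lemma cone_reflect_field_diff:
  assumes "\<gamma> \<noteq> 0"
  shows "cone_reflect_field \<gamma> (\<lambda>a. cone_reflect_field \<gamma> K a - K a) a = - (cone_reflect_field \<gamma> K a - K a)"
  by (simp add: cone_reflect_field_def pullback_simps pullback_cone_reflection_involution[OF assms]
      dual_reflection_involution[OF assms])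

text \<open>The prime forms of the arrangement in question do not divide \<open>z\<close>, so they
  divide the quotient.\<close>

lemma partial_shi_field_divide:
  assumes P: "\<And>\<beta>. \<beta> \<in> P \<Longrightarrow> \<beta> \<noteq> 0" and K: "partial_shi_field P k \<gamma> (Suc n) K"
    and q: "\<And>a. K a = lform snd_blinfun * q a"
  shows "partial_shi_field P k \<gamma> n q"
  unfolding partial_shi_field_def
proof (intro conjI allI ballI impI)
  show "linear q"
    by (rule lform_mult_eq_linear[OF snd_blinfun_nonzero, of K])
       (use K q in \<open>auto simp: partial_shi_field_def\<close>)
  show "homogeneous_poly n (q a)" for a
  proof (rule homogeneous_poly_lform_cancel[OF _ snd_blinfun_nonzero])
    show "homogeneous_poly (Suc n) (lform snd_blinfun * q a)"
      using K unfolding q[of a, symmetric] partial_shi_field_def by blast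
  qed
  fix \<beta> j assume \<beta>: "\<beta> \<in> P" and j: "- int k < j" "j \<le> int k" "\<beta> = \<gamma> \<longrightarrow> j < int k"
  have "lform (cone_form \<beta> j) dvd lform snd_blinfun * q \<beta>"
    using K \<beta> j unfolding q[of \<beta>, symmetric] partial_shi_field_def by blast
  then show "lform (cone_form \<beta> j) dvd q \<beta>"
    using prime_elem_dvd_multD[OF prime_elem_lform[OF cone_form_nonzero[OF P[OF \<beta>]]]]
      cone_form_not_dvd(1)[OF P[OF \<beta>]] by blast
qed

lemma cone_reflect_field_divide:
  assumes "\<And>a. K a = lform snd_blinfun * q a" "\<And>a. cone_reflect_field \<gamma> K a = - K a"
  shows "cone_reflect_field \<gamma> q a = - q a"
proof -
  have "lform snd_blinfun * cone_reflect_field \<gamma> q a = lform snd_blinfun * (- q a)"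
    using assms(2)[of a]
    by (simp add: assms(1) cone_reflect_field_def pullback_simps(4) pullback_cone_reflection_form)
  then show ?thesis using snd_blinfun_nonzero by (metis lform_eq_0_iff mult_left_cancel)
qed

text \<open>The forms of parallel hyperplanes are pairwise coprime primes, and each restricts to
  \<open>\<beta>\<close> at \<open>z = 0\<close>.\<close>

lemma prod_cone_forms_dvd:
  assumes "\<beta> \<noteq> 0" "finite J" "\<And>j. j \<in> J \<Longrightarrow> lform (cone_form \<beta> j) dvd f"
  shows "lform \<beta> ^ card J dvd pullback zero_section f"
proof -
  have "(\<Prod>j\<in>J. lform (cone_form \<beta> j)) dvd f"
    using assms(2) prime_elem_lform[OF cone_form_nonzero[OF assms(1)]]
      cone_form_not_dvd(2)[OF assms(1)] assms(3) by (intro prod_prime_elem_dvd) auto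
  then have "pullback zero_section (\<Prod>j\<in>J. lform (cone_form \<beta> j)) dvd pullback zero_section f"
    by (rule pullback_dvd)
  then show ?thesis by (simp add: pullback_prod pullback_zero_section_cone_form)
qed

text \<open>
  At \<open>\<gamma>\<close> only \<open>2k - 1\<close> hyperplanes are available, but anti-invariance makes the restricted value
  at \<open>\<gamma>\<close> even in \<open>\<gamma>\<close>, which supplies the missing factor.
\<close>
lemma partial_shi_field_restrict:
  assumes P: "\<And>\<beta>. \<beta> \<in> P \<Longrightarrow> \<beta> \<noteq> 0" and \<gamma>: "\<gamma> \<in> P" and k: "k \<ge> 1"
    and K: "partial_shi_field P k \<gamma> n K" and anti: "\<And>a. cone_reflect_field \<gamma> K a = - K a"
  shows "(\<lambda>a. pullback zero_section (K a)) \<in> multi_fields P (2 * k) n"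
  unfolding multi_fields_def
proof (intro CollectI conjI allI ballI)
  let ?r = "\<lambda>a. pullback zero_section (K a)" and ?s = "pullback (reflection \<gamma>)"
  have lin: "linear K" and hom: "\<And>a. homogeneous_poly n (K a)"
    and dvd: "\<And>\<beta> j. \<lbrakk>\<beta> \<in> P; - int k < j; j \<le> int k; \<beta> = \<gamma> \<longrightarrow> j < int k\<rbrakk> \<Longrightarrow>
      lform (cone_form \<beta> j) dvd K \<beta>"
    using K by (auto simp: partial_shi_field_def)
  show "linear ?r" using linear_compose[OF lin linear_pullback] by (simp add: o_def)
  show "homogeneous_poly n (?r a)" for a by (intro homogeneous_poly_pullback hom)
  fix \<beta> assume \<beta>: "\<beta> \<in> P"
  show "lform \<beta> ^ (2 * k) dvd ?r \<beta>"
  proof (cases "\<beta> = \<gamma>")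
    case False
    have "card {- int k<..int k} = 2 * k" by simp
    moreover have "lform \<beta> ^ card {- int k<..int k} dvd ?r \<beta>"
      by (rule prod_cone_forms_dvd) (use P \<beta> False dvd in auto)
    ultimately show ?thesis by simp
  next
    case True
    obtain m where m: "2 * k = Suc m" using k by (cases "2 * k") auto
    \<comment> \<open>These are the \<open>2k - 1\<close> levels left at \<open>\<gamma>\<close>, an
      odd number.\<close>
    have "card {- int k<..<int k} = m" using m by simp
    moreover have "lform \<gamma> ^ card {- int k<..<int k} dvd ?r \<gamma>"
      by (rule prod_cone_forms_dvd) (use P \<gamma> dvd in auto)
    ultimately obtain h where h: "?r \<gamma> = lform \<gamma> ^ m * h" by (auto simp: dvd_def)
    have "pullback zero_section (cone_reflect_field \<gamma> K \<gamma>) = - ?s (?r \<gamma>)"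
      by (simp add: cone_reflect_field_def dual_reflection_self P[OF \<gamma>] linear_neg[OF lin] pullback_simps
          pullback_zero_section_cone_ext)
    then have "?s (?r \<gamma>) = ?r \<gamma>"
      using anti[of \<gamma>] by (simp add: pullback_simps)
    moreover have "?s (?r \<gamma>) = - (lform \<gamma> ^ m * ?s h)"
    proof -
      have "odd m" using m by presburger
      then show ?thesis
        by (simp add: h pullback_simps(4,8) pullback_reflection_lform dual_reflection_self P[OF \<gamma>] lform_linear)
    qed
    ultimately have "lform \<gamma> ^ m * (- ?s h) = lform \<gamma> ^ m * h" using h by simp
    then have "- ?s h = h" using P[OF \<gamma>] by (metis lform_eq_0_iff mult_left_cancel power_not_zero)
    \<comment> \<open>As \<open>- ?s h = h\<close>, the difference \<open>h - ?s h\<close> divisible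
      by \<open>\<gamma>\<close> equals \<open>2h\<close>.\<close>
    then have "lform \<gamma> dvd h + h"
      using lform_dvd_diff_reflection[OF P[OF \<gamma>], of h] by (metis diff_conv_add_uminus)
    then have "lform \<gamma> dvd (1/2) *\<^sub>R (h + h)" by (rule polyfun_dvd_scaleR)
    then have "lform \<gamma> dvd h" by (simp flip: scaleR_2)
    then show ?thesis unfolding True h m by (metis mult.commute mult_dvd_mono dvd_refl power_Suc)
  qed
qed

text \<open>The restriction vanishes by \<open>low\<close>, so \<open>z\<close> splits off; the
  quotient inherits the hypotheses one degree lower, until a constant divisible by \<open>z\<close>
  remains.\<close>

lemma partial_shi_field_eq_0:
  assumes P: "\<And>\<beta>. \<beta> \<in> P \<Longrightarrow> \<beta> \<noteq> 0" and \<gamma>: "\<gamma> \<in> P" and k: "k \<ge> 1"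
    and low: "\<forall>m<d. \<forall>g\<in>multi_fields P (2 * k) m. \<forall>a. g a = 0"
    and "n < d" "partial_shi_field P k \<gamma> n K" "\<And>a. cone_reflect_field \<gamma> K a = - K a"
  shows "K a = 0"
  using assms(5-)
proof (induction n arbitrary: K a)
  case (0 K)
  then have "lform snd_blinfun ^ 1 dvd K a"
    using low[rule_format, OF _ partial_shi_field_restrict[OF P \<gamma> k], of 0 K a] by (simp add: snd_dvd_iff)
  then show ?case
    using homogeneous_poly_lform_power_dvd[OF _ _ snd_blinfun_nonzero, of 0 "K a" 1] 0
    by (auto simp: partial_shi_field_def)
next
  case (Suc n K)
  have "lform snd_blinfun dvd K b" for b
    using low[rule_format, OF _ partial_shi_field_restrict[OF P \<gamma> k], of "Suc n" K b] Suc.prems by (simp add: snd_dvd_iff)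
  then obtain q where q: "\<And>b. K b = lform snd_blinfun * q b" unfolding dvd_def by metis
  have "q a = 0"
    using Suc.IH[OF _ partial_shi_field_divide[OF P Suc.prems(2) q] cone_reflect_field_divide[OF q Suc.prems(3)]]
      Suc.prems(1) by simp
  then show ?case using q by simp
qed

text \<open>In degree exactly \<open>d\<close> the bound \<open>low\<close> says nothing; equality
  of the restrictions supplies the first factor \<open>z\<close>, and the quotient lies below
  \<open>d\<close>.\<close>

lemma partial_shi_field_reflect_eq:
  fixes \<alpha> :: "nat \<Rightarrow> 'a::euclidean_space \<Rightarrow>\<^sub>L real"
  assumes root: "root_system \<Phi>" and simple: "simple_roots \<Phi> P \<alpha>" and i: "i \<in> {1..DIM('a)}"
    and k: "k \<ge> 1"
    and low: "\<forall>m<d. \<forall>g\<in>multi_fields P (2 * k) m. \<forall>a. g a = 0"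
    and K: "partial_shi_field P k (\<alpha> i) n K"
    and n: "n < d \<or> (n = d \<and> (\<forall>a. pullback zero_section (cone_reflect_field (\<alpha> i) K a) = pullback zero_section (K a)))"
  shows "cone_reflect_field (\<alpha> i) K a = K a"
proof -
  have half: "positive_half \<Phi> P" using simple_roots_positive_half[OF root simple] .
  have P: "\<beta> \<noteq> 0" if "\<beta> \<in> P" for \<beta>
    using that half root_system_nonzero[OF root] by (auto simp: positive_half_def)
  have \<alpha>i: "\<alpha> i \<in> P" using simple_root_positive[OF simple i] .
  let ?L = "\<lambda>a. cone_reflect_field (\<alpha> i) K a - K a"
  have L: "partial_shi_field P k (\<alpha> i) n ?L"
    using partial_shi_field_diff[OF partial_shi_field_reflect[OF root simple i K] K] .
  have anti: "cone_reflect_field (\<alpha> i) ?L a = - ?L a" for a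
    by (rule cone_reflect_field_diff[OF P[OF \<alpha>i]])
  have "?L a = 0"
  proof (cases "n < d")
    case True
    show ?thesis using partial_shi_field_eq_0[of P "\<alpha> i" k d n ?L, OF P \<alpha>i k low True L anti] .
  next
    case False
    then have nd: "n = d" and "pullback zero_section (?L b) = 0" for b
      using n by (auto simp: pullback_simps)
    then have "lform snd_blinfun dvd ?L b" for b by (simp add: snd_dvd_iff)
    then obtain q where q: "\<And>b. ?L b = lform snd_blinfun * q b" unfolding dvd_def by metis
    show ?thesis
    proof (cases n)
      case 0
      then have "homogeneous_poly 0 (?L a)" using L by (simp add: partial_shi_field_def)
      moreover have "lform snd_blinfun ^ 1 dvd ?L a" using q[of a] by simp
      ultimately show ?thesis
        by (rule homogeneous_poly_lform_power_dvd[OF _ _ snd_blinfun_nonzero]) simp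
    next
      case (Suc m)
      have "q a = 0"
        using partial_shi_field_eq_0[of P "\<alpha> i" k d m q, OF P \<alpha>i k low _
            partial_shi_field_divide[of P k "\<alpha> i" m ?L q, OF P L[unfolded Suc] q]
            cone_reflect_field_divide[of ?L q "\<alpha> i", OF q anti]] Suc nd by simp
      then show ?thesis using q by simp
    qed
  qed
  then show ?thesis by simp
qed

section \<open>From fields back to derivations on the cone\<close>

lemma Der_cone_eqI:
  fixes \<theta> \<theta>' :: "('a::euclidean_space \<times> real) polyfun \<Rightarrow> ('a \<times> real) polyfun"
  assumes "\<theta> \<in> Der" "\<theta>' \<in> Der" "\<theta> (lform snd_blinfun) = \<theta>' (lform snd_blinfun)"
    and "\<And>a. \<theta> (lform (a o\<^sub>L fst_blinfun)) = \<theta>' (lform (a o\<^sub>L fst_blinfun))"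
  shows "\<theta> = \<theta>'"
proof (rule Der_eqI[OF assms(1,2)])
  fix a :: "('a \<times> real) \<Rightarrow>\<^sub>L real"
  have lin: "linear \<theta>" "linear \<theta>'" using assms by (auto simp: Der_def)
  have "lform a = lform ((a o\<^sub>L zero_section) o\<^sub>L fst_blinfun) + blinfun_apply a (0, 1) *\<^sub>R lform snd_blinfun"
  proof (rule polyfun_eqI)
    fix p :: "'a \<times> real"
    have "blinfun_apply a p = blinfun_apply a ((fst p, 0) + snd p *\<^sub>R (0, 1))" by simp
    also have "\<dots> = blinfun_apply a (fst p, 0) + snd p * blinfun_apply a (0, 1)"
      unfolding blinfun.add_right blinfun.scaleR_right by simp
    finally show "poly_fun (lform a) p = poly_fun (lform ((a o\<^sub>L zero_section) o\<^sub>L fst_blinfun) +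
        blinfun_apply a (0, 1) *\<^sub>R lform snd_blinfun) p" by simp
  qed
  then show "\<theta> (lform a) = \<theta>' (lform a)"
    using assms(3,4) lin by (simp add: linear_add linear_cmul)
qed

lemma blinfun_inv_reflection:
  "\<gamma> \<noteq> 0 \<Longrightarrow> blinfun_inv (reflection \<gamma>) = reflection \<gamma>"
  "\<gamma> \<noteq> 0 \<Longrightarrow> blinfun_inv (cone_ext (reflection \<gamma>)) = cone_ext (reflection \<gamma>)"
  by (rule blinfun_inv_involution; simp add: reflection_involution)+

lemma der_act_reflection:
  "\<gamma> \<noteq> 0 \<Longrightarrow> der_act (reflection \<gamma>) \<theta> (lform a) =
     pullback (reflection \<gamma>) (\<theta> (lform (dual_reflection \<gamma> a)))"
  by (simp add: der_act_def poly_act_def blinfun_inv_reflection pullback_reflection_lform)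

lemma der_act_cone_reflection:
  "\<gamma> \<noteq> 0 \<Longrightarrow> der_act (cone_ext (reflection \<gamma>)) \<theta> =
     (\<lambda>f. pullback (cone_ext (reflection \<gamma>)) (\<theta> (pullback (cone_ext (reflection \<gamma>)) f)))"
  by (simp add: der_act_def poly_act_def blinfun_inv_reflection)

lemma Der_der_act_cone_reflection:
  assumes "\<gamma> \<noteq> 0" "\<theta> \<in> Der"
  shows "der_act (cone_ext (reflection \<gamma>)) \<theta> \<in> Der"
proof -
  have "linear \<theta>" "\<And>f g. \<theta> (f * g) = \<theta> f * g + f * \<theta> g" using assms(2) by (auto simp: Der_def)
  then show ?thesis
    unfolding Der_def der_act_cone_reflection[OF assms(1)]
    by (auto intro!: linearI simp: pullback_simps linear_add linear_cmul
        pullback_cone_reflection_involution[OF assms(1)])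
qed

lemma der_act_cone_reflection_eqI:
  assumes "\<gamma> \<noteq> 0" "\<theta> \<in> Der" "\<theta> (lform snd_blinfun) = 0"
    and "\<And>a. cone_reflect_field \<gamma> (\<lambda>a. \<theta> (lform (a o\<^sub>L fst_blinfun))) a = \<theta> (lform (a o\<^sub>L fst_blinfun))"
  shows "der_act (cone_ext (reflection \<gamma>)) \<theta> = \<theta>"
  by (rule Der_cone_eqI[OF Der_der_act_cone_reflection[OF assms(1,2)] assms(2)])
     (use assms(3,4) in \<open>simp_all add: der_act_cone_reflection[OF assms(1)] pullback_cone_reflection_form
        pullback_simps(6) cone_reflect_field_def\<close>)

lemma linear_field_of_Der:
  fixes \<theta> :: "('a::euclidean_space \<times> real) polyfun \<Rightarrow> ('a \<times> real) polyfun"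
  assumes "\<theta> \<in> Der"
  shows "linear (\<lambda>a. \<theta> (lform (a o\<^sub>L fst_blinfun)))"
proof -
  have lin: "linear \<theta>" using assms by (simp add: Der_def)
  have "(lform ((a + b) o\<^sub>L fst_blinfun) :: ('a \<times> real) polyfun) = lform (a o\<^sub>L fst_blinfun) + lform (b o\<^sub>L fst_blinfun)"
    "(lform ((c *\<^sub>R a) o\<^sub>L fst_blinfun) :: ('a \<times> real) polyfun) = c *\<^sub>R lform (a o\<^sub>L fst_blinfun)"
    for a b :: "'a \<Rightarrow>\<^sub>L real" and c
    by (rule polyfun_eqI; simp add: blinfun.bilinear_simps)+
  then show ?thesis
    by (intro linearI) (simp_all add: linear_add[OF lin] linear_cmul[OF lin])
qed

text \<open>Since \<open>\<theta>\<close> kills \<open>z\<close>, it takes the same value on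
  \<open>\<beta> - j z\<close> as on \<open>\<beta>\<close>.\<close>

lemma D0_cone_form_dvd:
  assumes "\<theta> \<in> D0 (cone_shi P k)" "\<beta> \<in> P" "- int k < j" "j \<le> int k"
  shows "lform (cone_form \<beta> j) dvd \<theta> (lform (\<beta> o\<^sub>L fst_blinfun))"
proof -
  have \<theta>: "linear \<theta>" "\<theta> (lform snd_blinfun) = 0"
    and log: "\<And>a. {x. blinfun_apply a x = 0} \<in> cone_shi P k \<Longrightarrow> lform a dvd \<theta> (lform a)"
    using assms(1) unfolding D0_def log_derivations_def Der_def by blast+
  have "{x. blinfun_apply (cone_form \<beta> j) x = 0} \<in> cone_shi P k"
    unfolding cone_shi_def using assms by (intro insertI2 CollectI exI[of _ \<beta>] exI[of _ j]) auto
  then have "lform (cone_form \<beta> j) dvd \<theta> (lform (cone_form \<beta> j))" by (rule log)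
  then show ?thesis
    unfolding lform_cone_form[of \<beta> j] linear_diff[OF \<theta>(1)] linear_cmul[OF \<theta>(1)] \<theta>(2) by simp
qed

lemma D0_partial_shi_field:
  assumes "\<theta> \<in> degree_part (D0 (cone_shi P k)) d"
  shows "partial_shi_field P k \<gamma> d (\<lambda>a. \<theta> (lform (a o\<^sub>L fst_blinfun)))"
  unfolding partial_shi_field_def
proof (intro conjI allI ballI impI)
  have \<theta>: "\<theta> \<in> D0 (cone_shi P k)" "\<And>a. homogeneous_poly d (\<theta> (lform a))"
    using assms by (auto simp: degree_part_def)
  then have "\<theta> \<in> Der" by (auto simp: D0_def log_derivations_def)
  then show "linear (\<lambda>a. \<theta> (lform (a o\<^sub>L fst_blinfun)))" by (rule linear_field_of_Der)
  show "homogeneous_poly d (\<theta> (lform (a o\<^sub>L fst_blinfun)))" for a by (rule \<theta>)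
  show "lform (cone_form \<beta> j) dvd \<theta> (lform (\<beta> o\<^sub>L fst_blinfun))"
    if "\<beta> \<in> P" "- int k < j" "j \<le> int k" for \<beta> j
    using D0_cone_form_dvd[OF \<theta>(1) that] .
qed

section \<open>Invariance of the simple-root bases\<close>

lemma SRB_plus_reflection:
  fixes \<alpha> :: "nat \<Rightarrow> 'a::euclidean_space \<Rightarrow>\<^sub>L real"
  assumes root: "root_system \<Phi>" and irr: "irreducible_roots \<Phi>" and simple: "simple_roots \<Phi> P \<alpha>"
    and k: "k \<ge> 1" and srb: "SRB_plus \<Phi> P \<alpha> k \<phi>"
    and i: "i \<in> {1..DIM('a)}" and j: "j \<in> {1..DIM('a)}" "i \<noteq> j"
  shows "der_act (cone_ext (reflection (\<alpha> i))) (\<phi> j) = \<phi> j"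
proof -
  let ?d = "k * coxeter_number \<alpha>" and ?v = "dual_basis \<alpha> j"
  let ?K = "\<lambda>a. \<phi> j (lform (a o\<^sub>L fst_blinfun))"
  obtain \<Xi> \<Theta> where iso: "weyl_isomorphism \<Phi> (degree_part (multi_derivations P (2 * k)) ?d) \<Xi>"
    and \<Theta>: "\<And>v. \<Theta> v \<in> degree_part (D0 (cone_shi P k)) ?d" "\<And>v. ziegler_res (\<Theta> v) = \<Xi> v"
    and \<phi>: "\<And>j. j \<in> {1..DIM('a)} \<Longrightarrow> \<phi> j = \<Theta> (dual_basis \<alpha> j)"
    using srb unfolding SRB_plus_def by blast
  have low: "\<forall>m<?d. \<forall>g\<in>multi_fields P (2 * k) m. \<forall>a. g a = 0"
    using multi_fields_eq_0[OF root irr simple k iso] by blast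
  have \<phi>j: "\<phi> j \<in> degree_part (D0 (cone_shi P k)) ?d" using \<Theta> \<phi>[OF j(1)] by simp
  then have Der: "\<phi> j \<in> Der" "\<phi> j (lform snd_blinfun) = 0"
    by (auto simp: degree_part_def D0_def log_derivations_def)
  have \<alpha>i: "\<alpha> i \<in> \<Phi>" "\<alpha> i \<noteq> 0"
    using simple_rootsD(1)[OF simple] i root_system_nonzero[OF root] by blast+
  have res: "pullback zero_section (?K a) = \<Xi> ?v (lform a)" for a
    using \<Theta>(2)[of ?v] unfolding \<phi>[OF j(1)] ziegler_res_def by (metis pullback_simps(9))
  have "reflection (\<alpha> i) o\<^sub>L id_blinfun \<in> weyl_group \<Phi>"
    using weyl_group.intros \<alpha>i(1) by blast
  moreover have "reflection (\<alpha> i) o\<^sub>L id_blinfun = reflection (\<alpha> i)" by (rule blinfun_eqI) simp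
  ultimately have "\<Xi> (blinfun_apply (reflection (\<alpha> i)) ?v) = der_act (reflection (\<alpha> i)) (\<Xi> ?v)"
    using iso unfolding weyl_isomorphism_def by metis
  \<comment> \<open>\<open>\<alpha> i\<close> vanishes on the dual basis vector of index
    \<open>j\<close>, since \<open>i\<close> and \<open>j\<close> differ.\<close>
  moreover have "blinfun_apply (reflection (\<alpha> i)) ?v = ?v"
    using dual_basis_apply[OF simple j(1) i] j(2) by (simp add: reflection_apply)
  ultimately have inv: "der_act (reflection (\<alpha> i)) (\<Xi> ?v) = \<Xi> ?v" by simp
  have "pullback zero_section (cone_reflect_field (\<alpha> i) ?K a) = pullback zero_section (?K a)" for a
    unfolding cone_reflect_field_def pullback_zero_section_cone_ext res
    using der_act_reflection[OF \<alpha>i(2), of "\<Xi> ?v" a] inv by simp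
  then have "cone_reflect_field (\<alpha> i) ?K a = ?K a" for a
    using partial_shi_field_reflect_eq[of \<Phi> P \<alpha> i k ?d ?d ?K, OF root simple i k low
        D0_partial_shi_field[OF \<phi>j]] by blast
  then show ?thesis by (rule der_act_cone_reflection_eqI[OF \<alpha>i(2) Der])
qed

text \<open>Dividing by \<open>\<alpha> i - k z\<close> affects only the condition at that
  hyperplane, because the other forms are coprime to it, and drops the degree strictly below
  \<open>kh\<close>, where \<open>low\<close> applies directly.\<close>

lemma SRB_minus_reflection:
  fixes \<alpha> :: "nat \<Rightarrow> 'a::euclidean_space \<Rightarrow>\<^sub>L real"
  assumes root: "root_system \<Phi>" and irr: "irreducible_roots \<Phi>" and simple: "simple_roots \<Phi> P \<alpha>"
    and k: "k \<ge> 1" and srb: "SRB_minus \<Phi> P \<alpha> k \<psi>" and i: "i \<in> {1..DIM('a)}"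
    and Der: "\<theta> \<in> Der" and \<psi>: "\<psi> i = (\<lambda>f. lform (cone_form (\<alpha> i) (int k)) * \<theta> f)"
  shows "der_act (cone_ext (reflection (\<alpha> i))) \<theta> = \<theta>"
proof -
  let ?d = "k * coxeter_number \<alpha>" and ?l = "cone_form (\<alpha> i) (int k)"
  let ?K = "\<lambda>a. \<theta> (lform (a o\<^sub>L fst_blinfun))"
  obtain \<phi> where plus: "SRB_plus \<Phi> P \<alpha> k \<phi>"
    and sum: "\<psi> i = (\<lambda>f. \<Sum>p = 1..DIM('a). dual_inner (\<alpha> i) (\<alpha> p) *\<^sub>R \<phi> p f)"
    using srb i unfolding SRB_minus_def by blast
  obtain \<Xi> where iso: "weyl_isomorphism \<Phi> (degree_part (multi_derivations P (2 * k)) ?d) \<Xi>"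
    and \<phi>: "\<And>p. p \<in> {1..DIM('a)} \<Longrightarrow> \<phi> p \<in> degree_part (D0 (cone_shi P k)) ?d"
    using plus unfolding SRB_plus_def by metis
  have low: "\<forall>m<?d. \<forall>g\<in>multi_fields P (2 * k) m. \<forall>a. g a = 0"
    using multi_fields_eq_0[OF root irr simple k iso] by blast
  have half: "positive_half \<Phi> P" using simple_roots_positive_half[OF root simple] .
  have P: "\<beta> \<noteq> 0" if "\<beta> \<in> P" for \<beta>
    using that half root_system_nonzero[OF root] by (auto simp: positive_half_def)
  have \<alpha>i: "\<alpha> i \<in> P" "\<alpha> i \<noteq> 0" using simple_root_positive[OF simple i] P by auto
  have l: "?l \<noteq> 0" using cone_form_nonzero[OF \<alpha>i(2)] .
  have eq: "lform ?l * \<theta> f = (\<Sum>p = 1..DIM('a). dual_inner (\<alpha> i) (\<alpha> p) *\<^sub>R \<phi> p f)" for f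
    using fun_cong[OF \<psi>, of f] fun_cong[OF sum, of f] by simp
  have hom: "homogeneous_poly ?d (lform ?l * ?K a)" for a
    unfolding eq using \<phi>
    by (intro homogeneous_poly_sum homogeneous_poly_scaleR) (auto simp: degree_part_def)
  have dvd: "lform (cone_form \<beta> j) dvd lform ?l * ?K \<beta>"
    if "\<beta> \<in> P" "- int k < j" "j \<le> int k" for \<beta> j
    unfolding eq using \<phi> D0_cone_form_dvd[OF _ that]
    by (intro dvd_sum polyfun_dvd_scaleR) (auto simp: degree_part_def)
  have "lform ?l * \<theta> (lform snd_blinfun) = 0"
    unfolding eq using \<phi> by (intro sum.neutral) (auto simp: degree_part_def D0_def)
  then have z: "\<theta> (lform snd_blinfun) = 0" using l by simp
  have "cone_reflect_field (\<alpha> i) ?K a = ?K a" for a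
  proof (cases ?d)
    \<comment> \<open>Here the dividend is constant and divisible by a nonzero linear form, so all
      values vanish.\<close>
    case 0
    have "lform ?l * ?K b = 0" for b
      using homogeneous_poly_lform_power_dvd[OF hom[of b, unfolded 0] _ l, of 1] by simp
    then have "?K b = 0" for b using l by simp
    then show ?thesis by (simp add: cone_reflect_field_def pullback_simps)
  next
    case (Suc n)
    have "partial_shi_field P k (\<alpha> i) n ?K"
      unfolding partial_shi_field_def
    proof (intro conjI allI ballI impI)
      show "linear ?K" using Der by (rule linear_field_of_Der)
      show "homogeneous_poly n (?K a)" for a
        using homogeneous_poly_lform_cancel[OF hom[of a, unfolded Suc] l] .
      fix \<beta> j assume \<beta>: "\<beta> \<in> P" and j: "- int k < j" "j \<le> int k" "\<beta> = \<alpha> i \<longrightarrow> j < int k"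
      have "\<not> lform (cone_form \<beta> j) dvd lform ?l"
      proof (cases "\<beta> = \<alpha> i")
        case True
        then show ?thesis using j cone_form_not_dvd(2)[OF P[OF \<beta>], of "int k" j] by auto
      next
        case False
        then show ?thesis
          using cone_form_not_dvd(3)[OF P[OF \<beta>]] positive_half_not_dvd[OF root half \<beta> \<alpha>i(1)] by blast
      qed
      then show "lform (cone_form \<beta> j) dvd ?K \<beta>"
        using prime_elem_dvd_multD[OF prime_elem_lform[OF cone_form_nonzero[OF P[OF \<beta>]]] dvd[OF \<beta> j(1,2)]]
        by blast
    qed
    then show ?thesis
      using partial_shi_field_reflect_eq[of \<Phi> P \<alpha> i k ?d n ?K, OF root simple i k low] Suc by simp
  qed
  then show ?thesis by (rule der_act_cone_reflection_eqI[OF \<alpha>i(2) Der z])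
qed

theorem theorem3p5:
  fixes \<Phi> P :: "('a::euclidean_space \<Rightarrow>\<^sub>L real) set"
    and \<alpha> :: "nat \<Rightarrow> 'a \<Rightarrow>\<^sub>L real"
    and k :: nat
    and \<phi>p \<phi>m :: "nat \<Rightarrow> ('a \<times> real) polyfun \<Rightarrow> ('a \<times> real) polyfun"
  assumes "root_system \<Phi>" and "crystallographic \<Phi>" and "irreducible_roots \<Phi>"
    and "simple_roots \<Phi> P \<alpha>"
    and "k \<ge> 1"
    and "SRB_plus \<Phi> P \<alpha> k \<phi>p"
    and "SRB_minus \<Phi> P \<alpha> k \<phi>m"
  shows "\<forall>i\<in>{1..DIM('a)}.
           (\<forall>j\<in>{1..DIM('a)}. i \<noteq> j \<longrightarrow>
              der_act (cone_ext (reflection (\<alpha> i))) (\<phi>p j) = \<phi>p j) \<and>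
           (\<forall>\<phi>h\<in>Der. \<phi>m i = (\<lambda>f. lform (cone_form (\<alpha> i) (int k)) * \<phi>h f) \<longrightarrow>
              der_act (cone_ext (reflection (\<alpha> i))) \<phi>h = \<phi>h)"
  using SRB_plus_reflection[OF assms(1,3,4,5,6)] SRB_minus_reflection[OF assms(1,3,4,5,7)] by blast

end
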